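(* Let $(\tilde M,g)$ be an orientable Lorentzian $4$-manifold with a locally finite set of pointon worldlines $\beta_i\subset\tilde M$, and let $M$ be the associated internal spacetime. Let $\beta\subset\tilde M$ be one of these pointon worldlines, with tangent vector $v$. For each $p\in\tilde M$, let $h_{ab}:\tilde M_p\otimes\tilde M_p\to\mathbb R$ be a symmetric tensor such that $h_{ab}w_1^a=h_{ab}w_2^a$ (i.e. $h(w_1,-)=h(w_2,-)$ as linear functionals on $\tilde M_p$) whenever $w_1,w_2\in\tilde M_p$ are vectors for which the points $\exp_p(w_1),\exp_p(w_2)\in\tilde M$ are identified in $M$ but are not equal in $\tilde M$. Then $h_{ab}v^a=0$ (i.e. $h(v,-)=0$) at every point of any geodesic segment of $\beta$.
   Context: $\tilde M_p$ denotes the tangent space $T_p\tilde M$, and $\exp_p$ is the exponential map of $g$ at $p$ (defined on its natural domain in $\tilde M_p$). Indices $a,b$ are abstract indices. Pointon worldlines are the (nonconstant) curves $\beta_i$ in a fixed locally finite set of particle worldlines on $\tilde M$. The internal spacetime is the set $M:=(\tilde M\setminus\bigcup_i\beta_i)\cup\bigcup_j\{\beta_j\}$, in which each worldline $\beta_j$ is a single point. Thus two points of $\tilde M$ are "identified in $M$" when they lie on the same pointon worldline. A geodesic segment of $\beta$ is a restriction of $\beta$ to an interval of positive length on which $\beta$ is a geodesic of $(\tilde M,g)$. *)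

theory Defs
  imports "HOL-Analysis.Analysis"
begin

primrec C_diff_on :: "nat \<Rightarrow> ('a::euclidean_space \<Rightarrow> 'b::real_normed_vector) \<Rightarrow> 'a set \<Rightarrow> bool" where
  "C_diff_on 0 f S \<longleftrightarrow> continuous_on S f"
| "C_diff_on (Suc n) f S \<longleftrightarrow>
     (\<forall>x\<in>S. f differentiable (at x)) \<and> (\<forall>v. C_diff_on n (\<lambda>x. frechet_derivative f (at x) v) S)"

text \<open>Only used for open \<open>S\<close>.\<close>
definition smooth_on :: "('a::euclidean_space \<Rightarrow> 'b::real_normed_vector) \<Rightarrow> 'a set \<Rightarrow> bool" where
  "smooth_on f S \<longleftrightarrow> (\<forall>n. C_diff_on n f S)"

text \<open>A chart is a pair \<open>(U, \<phi>)\<close>; the values of \<open>\<phi>\<close> outside \<open>U\<close> are irrelevant.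
  The underlying space is an abstract topology \<open>X\<close>, so the points of the manifold are
  \<open>topspace X\<close>.\<close>
type_synonym 'm chart = "'m set \<times> ('m \<Rightarrow> real^4)"

definition is_chart :: "'m topology \<Rightarrow> 'm chart \<Rightarrow> bool" where
  "is_chart X c \<longleftrightarrow> openin X (fst c) \<and> open (snd c ` fst c) \<and>
     homeomorphic_map (subtopology X (fst c)) (top_of_set (snd c ` fst c)) (snd c)"

definition chart_inv :: "'m chart \<Rightarrow> real^4 \<Rightarrow> 'm" where
  "chart_inv c = inv_into (fst c) (snd c)"

definition transition :: "'m chart \<Rightarrow> 'm chart \<Rightarrow> real^4 \<Rightarrow> real^4" where
  "transition c d = snd d \<circ> chart_inv c"

definition compatible :: "'m chart \<Rightarrow> 'm chart \<Rightarrow> bool" where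
  "compatible c d \<longleftrightarrow> smooth_on (transition c d) (snd c ` (fst c \<inter> fst d)) \<and>
     smooth_on (transition d c) (snd d ` (fst c \<inter> fst d))"

definition smooth_4manifold :: "'m topology \<Rightarrow> 'm chart set \<Rightarrow> bool" where
  "smooth_4manifold X A \<longleftrightarrow>
     Hausdorff_space X \<and> second_countable X \<and>
     (\<forall>c\<in>A. is_chart X c) \<and> (\<Union>c\<in>A. fst c) = topspace X \<and>
     (\<forall>c\<in>A. \<forall>d\<in>A. compatible c d) \<and>
     (\<forall>c. is_chart X c \<and> (\<forall>d\<in>A. compatible c d) \<longrightarrow> c \<in> A)"

definition jacobian :: "'m chart \<Rightarrow> 'm chart \<Rightarrow> 'm \<Rightarrow> real^4 \<Rightarrow> real^4" where
  "jacobian c d p = frechet_derivative (transition c d) (at (snd c p))"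

definition orientable :: "'m topology \<Rightarrow> 'm chart set \<Rightarrow> bool" where
  "orientable X A \<longleftrightarrow> (\<exists>B\<subseteq>A. (\<Union>c\<in>B. fst c) = topspace X \<and>
     (\<forall>c\<in>B. \<forall>d\<in>B. \<forall>p\<in>fst c \<inter> fst d. det (matrix (jacobian c d p)) > 0))"

text \<open>A tangent vector at \<open>p\<close> is the family of its component vectors in all charts around \<open>p\<close>,
  related by the Jacobians of the coordinate changes. Components in all other charts
  are set to \<open>0\<close>, so that equality of tangent vectors is equality of functions. The vector space
  operations are pointwise.\<close>
type_synonym 'm tvec = "'m chart \<Rightarrow> real^4"

definition tangent_space :: "'m chart set \<Rightarrow> 'm \<Rightarrow> 'm tvec set" where
  "tangent_space A p = {w.
     (\<forall>c\<in>A. \<forall>d\<in>A. p \<in> fst c \<inter> fst d \<longrightarrow> w d = jacobian c d p (w c)) \<and>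
     (\<forall>c. \<not> (c \<in> A \<and> p \<in> fst c) \<longrightarrow> w c = 0)}"

definition tadd :: "'m tvec \<Rightarrow> 'm tvec \<Rightarrow> 'm tvec" where
  "tadd u w = (\<lambda>c. u c + w c)"

definition tscale :: "real \<Rightarrow> 'm tvec \<Rightarrow> 'm tvec" where
  "tscale r w = (\<lambda>c. r *\<^sub>R w c)"

text \<open>The coordinate vector field of \<open>c\<close> in direction \<open>i\<close>, at the point \<open>p\<close>.\<close>
definition coord_vector :: "'m chart set \<Rightarrow> 'm chart \<Rightarrow> 'm \<Rightarrow> 4 \<Rightarrow> 'm tvec" where
  "coord_vector A c p i = (\<lambda>d. if d \<in> A \<and> p \<in> fst d then jacobian c d p (axis i 1) else 0)"

type_synonym 'm tensor2 = "'m \<Rightarrow> 'm tvec \<Rightarrow> 'm tvec \<Rightarrow> real"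

definition symmetric_bilinear_on :: "'m tvec set \<Rightarrow> ('m tvec \<Rightarrow> 'm tvec \<Rightarrow> real) \<Rightarrow> bool" where
  "symmetric_bilinear_on T b \<longleftrightarrow>
     (\<forall>u\<in>T. \<forall>w\<in>T. b u w = b w u) \<and>
     (\<forall>u\<in>T. \<forall>w\<in>T. \<forall>z\<in>T. b (tadd u w) z = b u z + b w z) \<and>
     (\<forall>r. \<forall>u\<in>T. \<forall>z\<in>T. b (tscale r u) z = r * b u z)"

definition metric_matrix :: "'m chart set \<Rightarrow> 'm tensor2 \<Rightarrow> 'm chart \<Rightarrow> real^4 \<Rightarrow> real^4^4" where
  "metric_matrix A g c x = (\<chi> i j.
     g (chart_inv c x) (coord_vector A c (chart_inv c x) i) (coord_vector A c (chart_inv c x) j))"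

text \<open>Both sign conventions are admitted: signature \<open>(- + + +)\<close> for \<open>s = 1\<close> and
  \<open>(+ - - -)\<close> for \<open>s = -1\<close>, with the same \<open>s\<close> at all points. The numeral type \<open>4\<close> has the
  elements \<open>0, 1, 2, 3\<close>.\<close>
definition lorentzian_metric :: "'m topology \<Rightarrow> 'm chart set \<Rightarrow> 'm tensor2 \<Rightarrow> bool" where
  "lorentzian_metric X A g \<longleftrightarrow>
     (\<forall>p\<in>topspace X. symmetric_bilinear_on (tangent_space A p) (g p)) \<and>
     (\<forall>c\<in>A. smooth_on (metric_matrix A g c) (snd c ` fst c)) \<and>
     (\<exists>s\<in>{1, -1}. \<forall>p\<in>topspace X. \<exists>e :: 4 \<Rightarrow> 'm tvec.
        (\<forall>i. e i \<in> tangent_space A p) \<and>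
        (\<forall>i j. g p (e i) (e j) = s * (if i \<noteq> j then 0 else if i = 0 then -1 else 1)))"

definition lorentzian_4manifold :: "'m topology \<Rightarrow> 'm chart set \<Rightarrow> 'm tensor2 \<Rightarrow> bool" where
  "lorentzian_4manifold X A g \<longleftrightarrow> smooth_4manifold X A \<and> lorentzian_metric X A g"

text \<open>A curve is a map \<open>real \<Rightarrow> 'm\<close> together with its domain \<open>J\<close>, an interval of positive length
  with or without its endpoints; derivatives at endpoints in \<open>J\<close> are one-sided.\<close>
definition proper_interval :: "real set \<Rightarrow> bool" where
  "proper_interval J \<longleftrightarrow> is_interval J \<and> (\<exists>s\<in>J. \<exists>t\<in>J. s < t)"

definition deriv_within :: "real set \<Rightarrow> (real \<Rightarrow> real^4) \<Rightarrow> real \<Rightarrow> real^4" where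
  "deriv_within J f t = vector_derivative f (at t within J)"

text \<open>The coordinate expression \<open>snd c \<circ> \<gamma>\<close> is only meaningful where \<open>\<gamma>\<close> lies in the domain of \<open>c\<close>,
  which by continuity is a relatively open subset of \<open>J\<close>.\<close>
definition smooth_curve :: "'m topology \<Rightarrow> 'm chart set \<Rightarrow> real set \<Rightarrow> (real \<Rightarrow> 'm) \<Rightarrow> bool" where
  "smooth_curve X A J \<gamma> \<longleftrightarrow> proper_interval J \<and> continuous_map (top_of_set J) X \<gamma> \<and>
     (\<forall>c\<in>A. \<forall>t\<in>J. \<gamma> t \<in> fst c \<longrightarrow>
        (\<forall>n. (deriv_within J ^^ n) (snd c \<circ> \<gamma>) differentiable (at t within J)))"

definition velocity :: "'m chart set \<Rightarrow> real set \<Rightarrow> (real \<Rightarrow> 'm) \<Rightarrow> real \<Rightarrow> 'm tvec" where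
  "velocity A J \<gamma> t = (\<lambda>c. if c \<in> A \<and> \<gamma> t \<in> fst c then deriv_within J (snd c \<circ> \<gamma>) t else 0)"

definition metric_deriv ::
    "'m chart set \<Rightarrow> 'm tensor2 \<Rightarrow> 'm chart \<Rightarrow> real^4 \<Rightarrow> 4 \<Rightarrow> 4 \<Rightarrow> 4 \<Rightarrow> real" where
  "metric_deriv A g c x k i j =
     frechet_derivative (\<lambda>y. metric_matrix A g c y $ i $ j) (at x) (axis k 1)"

definition christoffel ::
    "'m chart set \<Rightarrow> 'm tensor2 \<Rightarrow> 'm chart \<Rightarrow> real^4 \<Rightarrow> 4 \<Rightarrow> 4 \<Rightarrow> 4 \<Rightarrow> real" where
  "christoffel A g c x k i j = (1/2) * (\<Sum>l\<in>UNIV. matrix_inv (metric_matrix A g c x) $ k $ l *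
     (metric_deriv A g c x i j l + metric_deriv A g c x j i l - metric_deriv A g c x l i j))"

text \<open>Geodesics of the Levi-Civita connection, affinely parametrised.\<close>
definition is_geodesic ::
    "'m topology \<Rightarrow> 'm chart set \<Rightarrow> 'm tensor2 \<Rightarrow> real set \<Rightarrow> (real \<Rightarrow> 'm) \<Rightarrow> bool" where
  "is_geodesic X A g J \<gamma> \<longleftrightarrow> smooth_curve X A J \<gamma> \<and>
     (\<forall>c\<in>A. \<forall>t\<in>J. \<gamma> t \<in> fst c \<longrightarrow>
        (\<forall>k. deriv_within J (deriv_within J (snd c \<circ> \<gamma>)) t $ k +
           (\<Sum>i\<in>UNIV. \<Sum>j\<in>UNIV. christoffel A g c (snd c (\<gamma> t)) k i j *
              deriv_within J (snd c \<circ> \<gamma>) t $ i * deriv_within J (snd c \<circ> \<gamma>) t $ j) = 0))"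

definition geodesic_from ::
    "'m topology \<Rightarrow> 'm chart set \<Rightarrow> 'm tensor2 \<Rightarrow> 'm \<Rightarrow> 'm tvec \<Rightarrow> real set \<Rightarrow> (real \<Rightarrow> 'm) \<Rightarrow> bool" where
  "geodesic_from X A g p w J \<gamma> \<longleftrightarrow>
     is_geodesic X A g J \<gamma> \<and> {0..1} \<subseteq> J \<and> \<gamma> 0 = p \<and> velocity A J \<gamma> 0 = w"

definition exp_domain ::
    "'m topology \<Rightarrow> 'm chart set \<Rightarrow> 'm tensor2 \<Rightarrow> 'm \<Rightarrow> 'm tvec set" where
  "exp_domain X A g p = {w \<in> tangent_space A p. \<exists>J \<gamma>. geodesic_from X A g p w J \<gamma>}"

definition exp_map ::
    "'m topology \<Rightarrow> 'm chart set \<Rightarrow> 'm tensor2 \<Rightarrow> 'm \<Rightarrow> 'm tvec \<Rightarrow> 'm" where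
  "exp_map X A g p w = (THE q. \<exists>J \<gamma>. geodesic_from X A g p w J \<gamma> \<and> \<gamma> 1 = q)"

type_synonym 'm curve = "real set \<times> (real \<Rightarrow> 'm)"

definition trace_of :: "'m curve \<Rightarrow> 'm set" where
  "trace_of b = snd b ` fst b"

definition is_worldline :: "'m topology \<Rightarrow> 'm chart set \<Rightarrow> 'm curve \<Rightarrow> bool" where
  "is_worldline X A b \<longleftrightarrow> smooth_curve X A (fst b) (snd b) \<and>
     (\<exists>s\<in>fst b. \<exists>t\<in>fst b. snd b s \<noteq> snd b t)"

definition pointon_worldlines :: "'m topology \<Rightarrow> 'm chart set \<Rightarrow> 'm curve set \<Rightarrow> bool" where
  "pointon_worldlines X A W \<longleftrightarrow>
     (\<forall>b\<in>W. is_worldline X A b) \<and> locally_finite_in X (trace_of ` W)"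

text \<open>A point \<open>p\<close> off all worldlines is represented by \<open>{p}\<close>, so that both kinds of
  elements are sets of points of the manifold. Worldlines may intersect.\<close>
definition internal_spacetime :: "'m topology \<Rightarrow> 'm curve set \<Rightarrow> 'm set set" where
  "internal_spacetime X W =
     (\<lambda>p. {p}) ` (topspace X - (\<Union>b\<in>W. trace_of b)) \<union> trace_of ` W"

definition identified :: "'m topology \<Rightarrow> 'm curve set \<Rightarrow> 'm \<Rightarrow> 'm \<Rightarrow> bool" where
  "identified X W p q \<longleftrightarrow> (\<exists>P\<in>internal_spacetime X W. p \<in> P \<and> q \<in> P)"

definition geodesic_segment ::
    "'m topology \<Rightarrow> 'm chart set \<Rightarrow> 'm tensor2 \<Rightarrow> 'm curve \<Rightarrow> real set \<Rightarrow> bool" where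
  "geodesic_segment X A g b J \<longleftrightarrow> J \<subseteq> fst b \<and> is_geodesic X A g J (snd b)"

end

(* Reparametrising the worldline affinely shows exp_p(s v) = beta(t + s) for all small s. Two small
   nonzero parameters with distinct points on beta therefore give s h(v,-) = s' h(v,-) with s, s'
   distinct, and such parameters exist unless v = 0. As the exponential map is a definite
   description, identifying its value needs uniqueness of geodesics, here only inside one chart:
   the Christoffel symbols are Lipschitz on compact convex sets (Cramer's rule handles the inverse
   metric), which gives local uniqueness, and the set where two geodesics agree to first order is
   open and closed. *)
theory Submission
  imports Defs
begin

section \<open>Bounded Lipschitz functions\<close>

text \<open>Two features of the curves shape the argument. The point p may sit at an endpoint of the
  parameter interval, so every derivative is taken within an interval and s may be confined to one
  sign. A worldline may also pass through the same point more than once, so distinct parameters do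
  not guarantee distinct points; a nonzero coordinate velocity is what yields distinct points
  arbitrarily close to p. Both vectors that are compared are nonzero multiples of v because the
  affine reparametrisation divides by s. The definite description in \<open>exp_map\<close> ranges
  over all geodesics with the given initial vector, on any interval containing
  \<open>{0..1}\<close>, including curves that might leave the chart. Uniqueness is therefore stated
  with only one of the two curves confined to the chart; taking s small keeps the piece of the
  worldline there.\<close>

definition lip_bdd :: "'a::metric_space set \<Rightarrow> ('a \<Rightarrow> 'b::real_normed_vector) \<Rightarrow> bool" where
  "lip_bdd K f \<longleftrightarrow> (\<exists>B. \<forall>x\<in>K. norm (f x) \<le> B) \<and>
     (\<exists>L. \<forall>x\<in>K. \<forall>y\<in>K. norm (f x - f y) \<le> L * dist x y)"

lemma lip_bddE:
  assumes "lip_bdd K f"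
  obtains B L where "B \<ge> 0" "L \<ge> 0" "\<And>x. x \<in> K \<Longrightarrow> norm (f x) \<le> B"
    "\<And>x y. x \<in> K \<Longrightarrow> y \<in> K \<Longrightarrow> norm (f x - f y) \<le> L * dist x y"
proof -
  obtain B L where B: "\<forall>x\<in>K. norm (f x) \<le> B"
    and L: "\<forall>x\<in>K. \<forall>y\<in>K. norm (f x - f y) \<le> L * dist x y"
    using assms unfolding lip_bdd_def by blast
  have "L * dist x y \<le> max L 0 * dist x y" for x y :: 'a
    by (simp add: mult_right_mono)
  then have "norm (f x - f y) \<le> max L 0 * dist x y" if "x \<in> K" "y \<in> K" for x y
    using L that order_trans by blast
  moreover have "norm (f x) \<le> max B 0" if "x \<in> K" for x
    using B that by fastforce
  ultimately show thesis
    by (intro that[of "max B 0" "max L 0"]) auto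
qed

lemma lip_bddI:
  assumes "\<And>x. x \<in> K \<Longrightarrow> norm (f x) \<le> B"
    "\<And>x y. x \<in> K \<Longrightarrow> y \<in> K \<Longrightarrow> norm (f x - f y) \<le> L * dist x y"
  shows "lip_bdd K f"
  using assms unfolding lip_bdd_def by blast

lemma lip_bdd_cong:
  assumes "\<And>x. x \<in> K \<Longrightarrow> f x = g x"
  shows "lip_bdd K f \<longleftrightarrow> lip_bdd K g"
  using assms by (simp add: lip_bdd_def)

lemma lip_bdd_const: "lip_bdd K (\<lambda>x. a)"
  by (rule lip_bddI[where L = 0 and B = "norm a"]) auto

lemma lip_bdd_add:
  assumes "lip_bdd K f" "lip_bdd K g"
  shows "lip_bdd K (\<lambda>x. f x + g x)"
proof -
  obtain B L where f: "B \<ge> 0" "L \<ge> 0" "\<And>x. x \<in> K \<Longrightarrow> norm (f x) \<le> B"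
    "\<And>x y. x \<in> K \<Longrightarrow> y \<in> K \<Longrightarrow> norm (f x - f y) \<le> L * dist x y"
    using assms(1) by (rule lip_bddE) (rule that)
  obtain C M where g: "C \<ge> 0" "M \<ge> 0" "\<And>x. x \<in> K \<Longrightarrow> norm (g x) \<le> C"
    "\<And>x y. x \<in> K \<Longrightarrow> y \<in> K \<Longrightarrow> norm (g x - g y) \<le> M * dist x y"
    using assms(2) by (rule lip_bddE) (rule that)
  show ?thesis
  proof (rule lip_bddI[where B = "B + C" and L = "L + M"])
    show "norm (f x + g x) \<le> B + C" if "x \<in> K" for x
      using f(3) g(3) that by (meson add_mono norm_triangle_le)
    show "norm (f x + g x - (f y + g y)) \<le> (L + M) * dist x y" if "x \<in> K" "y \<in> K" for x y
      using f(4)[OF that] g(4)[OF that] norm_triangle_ineq[of "f x - f y" "g x - g y"]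
      by (simp add: algebra_simps)
  qed
qed

lemma lip_bdd_bounded_linear:
  assumes "bounded_linear T" "lip_bdd K f"
  shows "lip_bdd K (\<lambda>x. T (f x))"
proof -
  interpret T: bounded_linear T by fact
  obtain B L where f: "B \<ge> 0" "L \<ge> 0" "\<And>x. x \<in> K \<Longrightarrow> norm (f x) \<le> B"
    "\<And>x y. x \<in> K \<Longrightarrow> y \<in> K \<Longrightarrow> norm (f x - f y) \<le> L * dist x y"
    using assms(2) by (rule lip_bddE) (rule that)
  obtain k where k: "k \<ge> 0" "\<And>x. norm (T x) \<le> norm x * k"
    using T.nonneg_bounded by blast
  show ?thesis
  proof (rule lip_bddI[where B = "B * k" and L = "L * k"])
    show "norm (T (f x)) \<le> B * k" if "x \<in> K" for x
      using k f(3)[OF that] by (meson mult_right_mono order_trans)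
    show "norm (T (f x) - T (f y)) \<le> (L * k) * dist x y" if "x \<in> K" "y \<in> K" for x y
    proof -
      have "norm (T (f x) - T (f y)) \<le> norm (f x - f y) * k"
        using k(2) by (simp flip: T.diff)
      also have "\<dots> \<le> (L * dist x y) * k"
        using f(4)[OF that] k(1) by (rule mult_right_mono)
      finally show ?thesis by (simp add: mult_ac)
    qed
  qed
qed

lemma lip_bdd_minus: "lip_bdd K f \<Longrightarrow> lip_bdd K (\<lambda>x. - f x)"
  by (rule lip_bdd_bounded_linear[OF bounded_linear_minus[OF bounded_linear_ident]])

lemma lip_bdd_diff: "lip_bdd K f \<Longrightarrow> lip_bdd K g \<Longrightarrow> lip_bdd K (\<lambda>x. f x - g x)"
  using lip_bdd_add[OF _ lip_bdd_minus, of K f g] by simp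

text \<open>The product rule is the reason for carrying a bound in \<open>lip_bdd\<close>: a product
  of unbounded Lipschitz functions need not be Lipschitz, whereas f x g x - f y g y = f x (g x - g
  y) + (f x - f y) g y is controlled by the bounds of both factors.\<close>

lemma lip_bdd_mult:
  fixes f g :: "'a::metric_space \<Rightarrow> real"
  assumes "lip_bdd K f" "lip_bdd K g"
  shows "lip_bdd K (\<lambda>x. f x * g x)"
proof -
  obtain B L where f: "B \<ge> 0" "L \<ge> 0" "\<And>x. x \<in> K \<Longrightarrow> norm (f x) \<le> B"
    "\<And>x y. x \<in> K \<Longrightarrow> y \<in> K \<Longrightarrow> norm (f x - f y) \<le> L * dist x y"
    using assms(1) by (rule lip_bddE) (rule that)
  obtain C M where g: "C \<ge> 0" "M \<ge> 0" "\<And>x. x \<in> K \<Longrightarrow> norm (g x) \<le> C"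
    "\<And>x y. x \<in> K \<Longrightarrow> y \<in> K \<Longrightarrow> norm (g x - g y) \<le> M * dist x y"
    using assms(2) by (rule lip_bddE) (rule that)
  show ?thesis
  proof (rule lip_bddI[where B = "B * C" and L = "B * M + L * C"])
    show "norm (f x * g x) \<le> B * C" if "x \<in> K" for x
      unfolding norm_mult using f(1,3) g(3) that by (intro mult_mono) auto
    show "norm (f x * g x - f y * g y) \<le> (B * M + L * C) * dist x y" if "x \<in> K" "y \<in> K" for x y
    proof -
      have "f x * g x - f y * g y = f x * (g x - g y) + (f x - f y) * g y"
        by (simp add: algebra_simps)
      also have "norm \<dots> \<le> norm (f x) * norm (g x - g y) + norm (f x - f y) * norm (g y)"
        by (metis norm_mult norm_triangle_ineq)
      also have "\<dots> \<le> B * (M * dist x y) + (L * dist x y) * C"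
        using f(1,2) f(3)[OF that(1)] f(4)[OF that] g(1,2) g(3)[OF that(2)] g(4)[OF that]
        by (intro add_mono mult_mono) auto
      finally show ?thesis by (simp add: algebra_simps)
    qed
  qed
qed

lemma lip_bdd_sum:
  assumes "\<And>i. i \<in> I \<Longrightarrow> lip_bdd K (f i)"
  shows "lip_bdd K (\<lambda>x. \<Sum>i\<in>I. f i x)"
  using assms by (induction I rule: infinite_finite_induct) (auto intro: lip_bdd_const lip_bdd_add)

lemma lip_bdd_prod:
  fixes f :: "'i \<Rightarrow> 'a::metric_space \<Rightarrow> real"
  assumes "\<And>i. i \<in> I \<Longrightarrow> lip_bdd K (f i)"
  shows "lip_bdd K (\<lambda>x. \<Prod>i\<in>I. f i x)"
  using assms by (induction I rule: infinite_finite_induct) (auto intro: lip_bdd_const lip_bdd_mult)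

text \<open>Compactness turns pointwise nonvanishing into a uniform bound B for the reciprocal. The
  difference of two reciprocals is the difference of the values times two such reciprocals, whence
  the constant \<open>B * L * B\<close>.\<close>

lemma lip_bdd_inverse:
  fixes f :: "'a::metric_space \<Rightarrow> real"
  assumes "lip_bdd K f" "compact K" "\<And>x. x \<in> K \<Longrightarrow> f x \<noteq> 0"
  shows "lip_bdd K (\<lambda>x. inverse (f x))"
proof -
  obtain C L where f: "C \<ge> 0" "L \<ge> 0" "\<And>x. x \<in> K \<Longrightarrow> norm (f x) \<le> C"
    "\<And>x y. x \<in> K \<Longrightarrow> y \<in> K \<Longrightarrow> norm (f x - f y) \<le> L * dist x y"
    using assms(1) by (rule lip_bddE) (rule that)
  have "L-lipschitz_on K f"
    using f(2,4) by (intro lipschitz_onI) (auto simp: dist_norm)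
  then have "continuous_on K (\<lambda>x. inverse (f x))"
    using assms(3) by (intro continuous_on_inverse lipschitz_on_continuous_on) auto
  then have "bounded ((\<lambda>x. inverse (f x)) ` K)"
    using assms(2) compact_continuous_image compact_imp_bounded by blast
  then obtain B where B: "B > 0" "\<And>x. x \<in> K \<Longrightarrow> norm (inverse (f x)) \<le> B"
    by (auto simp: bounded_pos)
  show ?thesis
  proof (rule lip_bddI[OF B(2), where L = "B * L * B"])
    show "norm (inverse (f x) - inverse (f y)) \<le> (B * L * B) * dist x y" if "x \<in> K" "y \<in> K" for x y
    proof -
      have "inverse (f x) - inverse (f y) = - (inverse (f x) * (f x - f y) * inverse (f y))"
        using assms(3) that by (intro inverse_diff_inverse)
      then have "norm (inverse (f x) - inverse (f y)) =
        norm (inverse (f x)) * norm (f x - f y) * norm (inverse (f y))"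
        by (simp add: norm_mult abs_mult)
      also have "\<dots> \<le> B * (L * dist x y) * B"
        using B(1) B(2)[OF that(1)] B(2)[OF that(2)] f(2) f(4)[OF that] by (intro mult_mono) auto
      finally show ?thesis by (simp add: mult_ac)
    qed
  qed
qed

lemma lip_bdd_vec:
  fixes f :: "'n::finite \<Rightarrow> 'a::metric_space \<Rightarrow> real"
  assumes "\<And>k. lip_bdd K (f k)"
  shows "lip_bdd K (\<lambda>x. \<chi> k. f k x)"
proof -
  have "(\<lambda>x. \<chi> k. f k x) = (\<lambda>x. \<Sum>k\<in>UNIV. f k x *\<^sub>R axis k 1)"
    by (simp add: fun_eq_iff vec_eq_iff axis_def if_distrib cong: if_cong)
  moreover have "lip_bdd K (\<lambda>x. f k x *\<^sub>R axis k 1 :: real^'n)" for k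
    by (rule lip_bdd_bounded_linear[OF bounded_linear_scaleR_left assms])
  ultimately show ?thesis
    by (simp add: lip_bdd_sum)
qed

lemma lip_bdd_Pair:
  assumes "lip_bdd K f" "lip_bdd K g"
  shows "lip_bdd K (\<lambda>x. (f x, g x))"
proof -
  have "lip_bdd K (\<lambda>x. (f x, 0) + (0, g x))"
    by (intro lip_bdd_add lip_bdd_bounded_linear[OF _ assms(1)] lip_bdd_bounded_linear[OF _ assms(2)]
          bounded_linear_Pair bounded_linear_ident bounded_linear_zero)
  then show ?thesis by simp
qed

lemma lip_bdd_fst:
  assumes "lip_bdd K f"
  shows "lip_bdd (K \<times> K') (\<lambda>z. f (fst z))"
proof -
  obtain B L where f: "B \<ge> 0" "L \<ge> 0" "\<And>x. x \<in> K \<Longrightarrow> norm (f x) \<le> B"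
    "\<And>x y. x \<in> K \<Longrightarrow> y \<in> K \<Longrightarrow> norm (f x - f y) \<le> L * dist x y"
    using assms by (rule lip_bddE) (rule that)
  show ?thesis
  proof (rule lip_bddI[where B = B and L = L])
    show "norm (f (fst z)) \<le> B" if "z \<in> K \<times> K'" for z
      using that f(3) by auto
    show "norm (f (fst z) - f (fst w)) \<le> L * dist z w" if "z \<in> K \<times> K'" "w \<in> K \<times> K'" for z w
      using f(4)[of "fst z" "fst w"] that mult_left_mono[OF dist_fst_le[of z w] f(2)] by auto
  qed
qed

lemma lip_bdd_snd:
  fixes K' :: "'b::real_normed_vector set"
  assumes "bounded K'"
  shows "lip_bdd (K \<times> K') snd"
proof -
  obtain B where "\<And>x. x \<in> K' \<Longrightarrow> norm x \<le> B"
    using assms by (auto simp: bounded_iff)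
  then show ?thesis
    by (intro lip_bddI[where B = B and L = 1]) (auto simp: dist_snd_le simp flip: dist_norm)
qed

lemma lip_bdd_det:
  fixes M :: "'a::metric_space \<Rightarrow> real^'n^'n"
  assumes "\<And>i j. lip_bdd K (\<lambda>x. M x $ i $ j)"
  shows "lip_bdd K (\<lambda>x. det (M x))"
  unfolding det_def by (intro lip_bdd_sum lip_bdd_mult lip_bdd_const lip_bdd_prod assms)

section \<open>Inverse matrices, mean value bounds and an ODE uniqueness estimate\<close>

lemma matrix_inv_cramer:
  fixes M :: "real^'n^'n"
  assumes "det M \<noteq> 0"
  shows "matrix_inv M $ k $ l = det (\<chi> i j. if j = k then axis l 1 $ i else M $ i $ j) / det M"
proof -
  \<comment> \<open>\<open>matrix_inv\<close> is a choice operator, so its defining property is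
    available only once some inverse is known to exist.\<close>
  have "\<exists>N. M ** N = mat 1 \<and> N ** M = mat 1"
    using assms by (simp add: invertible_det_nz flip: invertible_def)
  then have "M ** matrix_inv M = mat 1"
    unfolding matrix_inv_def by (rule someI2_ex) simp
  \<comment> \<open>Column l of the inverse solves M x = e_l, which is the linear system to which
    Cramer's rule is applied.\<close>
  then have "M *v (matrix_inv M *v axis l 1) = axis l 1"
    by (simp add: matrix_vector_mul_assoc)
  then have "matrix_inv M *v axis l 1 =
      (\<chi> k. det (\<chi> i j. if j = k then axis l 1 $ i else M $ i $ j) / det M)"
    using cramer[OF assms] by blast
  moreover have "(matrix_inv M *v axis l 1) $ k = matrix_inv M $ k $ l"
    by (simp add: matrix_vector_mult_basis column_def)
  ultimately show ?thesis by simp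
qed

lemma lip_bdd_matrix_inv:
  fixes M :: "'a::metric_space \<Rightarrow> real^'n^'n"
  assumes "\<And>i j. lip_bdd K (\<lambda>x. M x $ i $ j)" "compact K" "\<And>x. x \<in> K \<Longrightarrow> det (M x) \<noteq> 0"
  shows "lip_bdd K (\<lambda>x. matrix_inv (M x) $ k $ l)"
proof -
  have "lip_bdd K (\<lambda>x. det (\<chi> i j. if j = k then axis l 1 $ i else M x $ i $ j) * inverse (det (M x)))"
  proof (intro lip_bdd_mult lip_bdd_inverse lip_bdd_det assms)
    show "lip_bdd K (\<lambda>x. (\<chi> i j. if j = k then axis l 1 $ i else M x $ i $ j) $ i $ j)" for i j
      using assms(1) by (cases "j = k") (simp_all add: lip_bdd_const)
  qed
  then show ?thesis
    by (rule iffD1[OF lip_bdd_cong, rotated]) (simp add: matrix_inv_cramer assms(3) divide_inverse)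
qed

lemma lip_bdd_C_diff_on_1:
  fixes f :: "'a::euclidean_space \<Rightarrow> 'b::real_normed_vector"
  assumes "C_diff_on (Suc 0) f S" "K \<subseteq> S" "compact K" "convex K"
  shows "lip_bdd K f"
proof -
  have der: "(f has_derivative frechet_derivative f (at x)) (at x)" if "x \<in> S" for x
    using assms(1) that by (simp add: frechet_derivative_works)
  \<comment> \<open>\<open>C_diff_on\<close> gives continuity of the derivative one direction at a
    time, not in operator norm. The operator norm is therefore bounded by the sum of the bounds in
    the finitely many basis directions, and the mean value inequality on the convex set does the
    rest.\<close>
  have "bounded ((\<lambda>x. frechet_derivative f (at x) b) ` K)" for b
    using assms by (auto intro!: compact_imp_bounded compact_continuous_image intro: continuous_on_subset)
  then have "\<exists>B. \<forall>x\<in>K. norm (frechet_derivative f (at x) b) \<le> B" for b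
    by (simp add: bounded_iff)
  then obtain B where B: "\<And>b x. x \<in> K \<Longrightarrow> norm (frechet_derivative f (at x) b) \<le> B b"
    by metis
  have "onorm (frechet_derivative f (at x)) \<le> (\<Sum>b\<in>Basis. B b)" if "x \<in> K" for x
  proof (rule onorm_le)
    fix v :: 'a
    have lin: "linear (frechet_derivative f (at x))"
      using der assms(2) that by (blast intro: has_derivative_linear)
    have "frechet_derivative f (at x) v = frechet_derivative f (at x) (\<Sum>b\<in>Basis. (v \<bullet> b) *\<^sub>R b)"
      by (simp add: euclidean_representation)
    also have "\<dots> = (\<Sum>b\<in>Basis. (v \<bullet> b) *\<^sub>R frechet_derivative f (at x) b)"
      by (simp add: linear_sum[OF lin] linear_scale[OF lin])
    also have "norm \<dots> \<le> (\<Sum>b\<in>Basis. norm v * B b)"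
      using Basis_le_norm B[OF that] by (intro sum_norm_le) (auto intro!: mult_mono)
    finally show "norm (frechet_derivative f (at x) v) \<le> (\<Sum>b\<in>Basis. B b) * norm v"
      by (simp add: sum_distrib_left mult.commute)
  qed
  then have "norm (f x - f y) \<le> (\<Sum>b\<in>Basis. B b) * norm (x - y)" if "x \<in> K" "y \<in> K" for x y
    using der assms(2) that
    by (intro differentiable_bound[OF assms(4)]) (auto intro: has_derivative_at_withinI)
  moreover have "continuous_on K f"
    using der assms(2) by (meson continuous_at_imp_continuous_on has_derivative_continuous subsetD)
  then have "bounded (f ` K)"
    using assms(3) compact_continuous_image compact_imp_bounded by blast
  ultimately show ?thesis
    by (auto simp: lip_bdd_def bounded_iff dist_norm)
qed

text \<open>On a short interval a maximum argument replaces Gronwall: if the difference u has its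
  largest norm at m, the mean value inequality from t0 gives |u m| \<le> d L |u m|, and d L < 1
  forces u = 0.\<close>

lemma ode_local_unique:
  fixes y z :: "real \<Rightarrow> 'a::real_normed_vector"
  assumes der: "\<And>t. t \<in> I \<Longrightarrow> (y has_vector_derivative F (y t)) (at t within I)"
      "\<And>t. t \<in> I \<Longrightarrow> (z has_vector_derivative F (z t)) (at t within I)"
    and K: "y ` I \<subseteq> K" "z ` I \<subseteq> K"
    and L: "\<And>x w. x \<in> K \<Longrightarrow> w \<in> K \<Longrightarrow> norm (F x - F w) \<le> L * dist x w" "L \<ge> 0"
    and I: "convex I" "compact I" "t0 \<in> I" "\<And>t. t \<in> I \<Longrightarrow> \<bar>t - t0\<bar> \<le> d" "d * L < 1"
    and "y t0 = z t0" "t \<in> I"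
  shows "y t = z t"
proof -
  define u where "u = (\<lambda>t. y t - z t)"
  have du: "(u has_vector_derivative F (y t) - F (z t)) (at t within I)" if "t \<in> I" for t
    unfolding u_def by (intro derivative_intros der that)
  then have "continuous_on I u"
    by (meson continuous_on_eq_continuous_within has_vector_derivative_continuous)
  then have "\<exists>m\<in>I. \<forall>t\<in>I. norm (u t) \<le> norm (u m)"
    using I(2,3) by (intro continuous_attains_sup continuous_intros) auto
  then obtain m where m: "m \<in> I" "\<And>t. t \<in> I \<Longrightarrow> norm (u t) \<le> norm (u m)" by blast
  have "norm (u m - u t0) \<le> (L * norm (u m)) * norm (m - t0)"
  proof (rule differentiable_bound[OF I(1) _ _ m(1) I(3)])
    show "(u has_derivative (\<lambda>h. h *\<^sub>R (F (y t) - F (z t)))) (at t within I)" if "t \<in> I" for t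
      using du[OF that] by (simp add: has_vector_derivative_def)
    show "onorm (\<lambda>h. h *\<^sub>R (F (y t) - F (z t))) \<le> L * norm (u m)" if "t \<in> I" for t
    proof (rule onorm_le)
      fix h :: real
      have "norm (F (y t) - F (z t)) \<le> L * norm (u t)"
        using L(1)[of "y t" "z t"] K that by (auto simp: u_def dist_norm)
      also have "\<dots> \<le> L * norm (u m)"
        using m(2)[OF that] L(2) by (rule mult_left_mono)
      finally show "norm (h *\<^sub>R (F (y t) - F (z t))) \<le> L * norm (u m) * norm h"
        by (simp add: mult.commute mult_left_mono)
    qed
  qed
  also have "\<dots> \<le> (L * norm (u m)) * d"
    using I(4)[OF m(1)] L(2) by (intro mult_left_mono) auto
  finally have "norm (u m) \<le> (d * L) * norm (u m)"
    using assms(12) by (simp add: u_def mult_ac)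
  then have "norm (u m) = 0"
    using I(5) by (smt (verit) mult_less_cancel_right2 norm_ge_zero)
  then show ?thesis
    using m(2)[OF assms(13)] by (simp add: u_def)
qed

section \<open>Charts, tangent spaces and the metric\<close>

lemma is_chartD:
  assumes "is_chart X c"
  shows "openin X (fst c)" "open (snd c ` fst c)" "inj_on (snd c) (fst c)"
    "fst c \<subseteq> topspace X"
    "openin X U \<Longrightarrow> U \<subseteq> fst c \<Longrightarrow> open (snd c ` U)"
proof -
  have h: "homeomorphic_map (subtopology X (fst c)) (top_of_set (snd c ` fst c)) (snd c)"
    and o: "openin X (fst c)" "open (snd c ` fst c)"
    using assms by (auto simp: is_chart_def)
  show "openin X (fst c)" "open (snd c ` fst c)" by fact+
  show top: "fst c \<subseteq> topspace X"
    using o openin_subset by blast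
  then show "inj_on (snd c) (fst c)"
    using h by (simp add: homeomorphic_eq_everything_map Int_absorb1)
  show "open (snd c ` U)" if "openin X U" "U \<subseteq> fst c"
  proof -
    have "openin (subtopology X (fst c)) U"
      using that o openin_open_subtopology by blast
    then have "openin (top_of_set (snd c ` fst c)) (snd c ` U)"
      using h by (simp add: homeomorphic_eq_everything_map open_map_def)
    then show ?thesis
      using o by (simp add: openin_open_eq)
  qed
qed

lemma smooth_4manifoldD:
  assumes "smooth_4manifold X A"
  shows "Hausdorff_space X" "c \<in> A \<Longrightarrow> is_chart X c"
    "c \<in> A \<Longrightarrow> d \<in> A \<Longrightarrow> compatible c d"
  using assms unfolding smooth_4manifold_def by - (elim conjE; simp only:)+

lemma chart_inv_apply:
  assumes "is_chart X c" "p \<in> fst c"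
  shows "chart_inv c (snd c p) = p"
  unfolding chart_inv_def using is_chartD(3)[OF assms(1)] assms(2) by simp

lemma transition_apply:
  assumes "is_chart X c" "p \<in> fst c"
  shows "transition c d (snd c p) = snd d p"
  by (simp add: transition_def chart_inv_apply[OF assms])

lemma transition_has_derivative:
  assumes "smooth_4manifold X A" "c \<in> A" "d \<in> A" "p \<in> fst c" "p \<in> fst d"
  shows "(transition c d has_derivative jacobian c d p) (at (snd c p))"
proof -
  have "smooth_on (transition c d) (snd c ` (fst c \<inter> fst d))"
    using smooth_4manifoldD(3)[OF assms(1-3)] by (simp add: compatible_def)
  then have "C_diff_on (Suc 0) (transition c d) (snd c ` (fst c \<inter> fst d))"
    unfolding smooth_on_def by blast
  then show ?thesis
    using assms(4,5) by (simp add: jacobian_def frechet_derivative_works)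
qed

lemma linear_jacobian:
  assumes "smooth_4manifold X A" "c \<in> A" "d \<in> A" "p \<in> fst c" "p \<in> fst d"
  shows "linear (jacobian c d p)"
  using transition_has_derivative[OF assms] has_derivative_linear by blast

lemma jacobian_cocycle:
  assumes M: "smooth_4manifold X A" and A: "c \<in> A" "d \<in> A" "e \<in> A"
    and p: "p \<in> fst c" "p \<in> fst d" "p \<in> fst e"
  shows "jacobian d e p (jacobian c d p v) = jacobian c e p v"
proof -
  have ch: "is_chart X c" "is_chart X d" "is_chart X e"
    using smooth_4manifoldD(2)[OF M] A by blast+
  \<comment> \<open>\<open>chart_inv\<close> is arbitrary off the chart image, so the composite of
    the two transitions can be compared with the direct one only on the image of the overlap of c
    and d. That this image is open lets the derivative at p be transferred.\<close>
  let ?V = "snd c ` (fst c \<inter> fst d)"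
  have op: "open ?V"
    by (intro is_chartD(5)[OF ch(1)] openin_Int is_chartD(1)[OF ch(1)] is_chartD(1)[OF ch(2)]) auto
  have "(transition d e has_derivative jacobian d e p) (at (transition c d (snd c p)))"
    using transition_has_derivative[OF M A(2,3) p(2,3)] by (simp add: transition_apply[OF ch(1) p(1)])
  from has_derivative_compose[OF transition_has_derivative[OF M A(1,2) p(1,2)] this]
  have "((\<lambda>x. transition d e (transition c d x)) has_derivative
      (\<lambda>v. jacobian d e p (jacobian c d p v))) (at (snd c p))" .
  then have "(transition c e has_derivative
      (\<lambda>v. jacobian d e p (jacobian c d p v))) (at (snd c p))"
    by (rule has_derivative_transform_within_open[OF _ op])
      (use p ch in \<open>auto simp: transition_apply\<close>)
  then show ?thesis
    using transition_has_derivative[OF M A(1,3) p(1,3)] has_derivative_unique by metis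
qed

lemma tangent_spaceI:
  assumes "\<And>c d. c \<in> A \<Longrightarrow> d \<in> A \<Longrightarrow> p \<in> fst c \<Longrightarrow> p \<in> fst d \<Longrightarrow> w d = jacobian c d p (w c)"
    "\<And>c. \<not> (c \<in> A \<and> p \<in> fst c) \<Longrightarrow> w c = 0"
  shows "w \<in> tangent_space A p"
  using assms unfolding tangent_space_def by blast

lemma tangent_spaceD:
  assumes "w \<in> tangent_space A p"
  shows "c \<in> A \<Longrightarrow> d \<in> A \<Longrightarrow> p \<in> fst c \<Longrightarrow> p \<in> fst d \<Longrightarrow> jacobian c d p (w c) = w d"
    "\<not> (c \<in> A \<and> p \<in> fst c) \<Longrightarrow> w c = 0"
proof -
  have w: "\<forall>c\<in>A. \<forall>d\<in>A. p \<in> fst c \<inter> fst d \<longrightarrow> w d = jacobian c d p (w c)"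
    "\<forall>c. \<not> (c \<in> A \<and> p \<in> fst c) \<longrightarrow> w c = 0"
    using assms unfolding tangent_space_def by blast+
  show "jacobian c d p (w c) = w d" if "c \<in> A" "d \<in> A" "p \<in> fst c" "p \<in> fst d"
    using w(1)[rule_format, OF that(1,2)] that(3,4) by simp
  show "w c = 0" if "\<not> (c \<in> A \<and> p \<in> fst c)"
    using w(2) that by blast
qed

lemma coord_vector_in_tangent_space:
  assumes "smooth_4manifold X A" "c \<in> A" "p \<in> fst c"
  shows "coord_vector A c p i \<in> tangent_space A p"
  by (rule tangent_spaceI) (use assms in \<open>auto simp: coord_vector_def jacobian_cocycle[OF assms(1)]\<close>)

lemma tangent_space_tadd:
  assumes "smooth_4manifold X A" "u \<in> tangent_space A p" "w \<in> tangent_space A p"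
  shows "tadd u w \<in> tangent_space A p"
  by (rule tangent_spaceI) (simp_all add: tadd_def linear_add[OF linear_jacobian[OF assms(1)]]
      tangent_spaceD[OF assms(2)] tangent_spaceD[OF assms(3)])

lemma tangent_space_tscale:
  assumes "smooth_4manifold X A" "u \<in> tangent_space A p"
  shows "tscale r u \<in> tangent_space A p"
  by (rule tangent_spaceI) (simp_all add: tscale_def linear_scale[OF linear_jacobian[OF assms(1)]]
      tangent_spaceD[OF assms(2)])

lemma tangent_space_sum:
  assumes M: "smooth_4manifold X A"
    and "finite I" "\<And>k. k \<in> I \<Longrightarrow> e k \<in> tangent_space A p"
  shows "(\<lambda>d. \<Sum>k\<in>I. a k *\<^sub>R e k d) \<in> tangent_space A p"
  using assms(2,3)
proof (induction I rule: finite_induct)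
  case empty
  show ?case
    by (rule tangent_spaceI) (simp_all add: linear_0[OF linear_jacobian[OF M]])
next
  case (insert k I)
  then have "tadd (tscale (a k) (e k)) (\<lambda>d. \<Sum>k\<in>I. a k *\<^sub>R e k d) \<in> tangent_space A p"
    by (intro tangent_space_tadd[OF M] tangent_space_tscale[OF M]) auto
  then show ?case
    using insert by (simp add: tadd_def tscale_def)
qed

section \<open>Bilinear forms in coordinates, nondegeneracy of the metric, Christoffel
  symbols\<close>

lemma symmetric_bilinear_on_tadd:
  assumes "symmetric_bilinear_on T b" "u \<in> T" "w \<in> T" "z \<in> T"
  shows "b (tadd u w) z = b u z + b w z"
  using assms unfolding symmetric_bilinear_on_def by blast

lemma symmetric_bilinear_on_tscale:
  assumes "symmetric_bilinear_on T b" "u \<in> T" "z \<in> T"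
  shows "b (tscale r u) z = r * b u z"
  using assms unfolding symmetric_bilinear_on_def by blast

lemma symmetric_bilinear_on_sum:
  assumes M: "smooth_4manifold X A"
    and b: "symmetric_bilinear_on (tangent_space A p) b"
    and e: "finite I" "\<And>k. k \<in> I \<Longrightarrow> e k \<in> tangent_space A p"
    and z: "z \<in> tangent_space A p"
  shows "b (\<lambda>d. \<Sum>k\<in>I. a k *\<^sub>R e k d) z = (\<Sum>k\<in>I. a k * b (e k) z)"
  using e
proof (induction I rule: finite_induct)
  case empty
  \<comment> \<open>The empty sum is the zero vector, written as a multiple of z so that homogeneity
    applies to it.\<close>
  have "b (tscale 0 z) z = 0"
    using symmetric_bilinear_on_tscale[OF b z z, of 0] by simp
  then show ?case by (simp add: tscale_def)
next
  case (insert k I)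
  have ek: "e k \<in> tangent_space A p"
    using insert by blast
  have "b (tadd (tscale (a k) (e k)) (\<lambda>d. \<Sum>k\<in>I. a k *\<^sub>R e k d)) z =
      b (tscale (a k) (e k)) z + b (\<lambda>d. \<Sum>k\<in>I. a k *\<^sub>R e k d) z"
    using insert.prems insert.hyps(1)
    by (intro symmetric_bilinear_on_tadd[OF b _ _ z] tangent_space_sum[OF M] tangent_space_tscale[OF M ek]) auto
  also have "\<dots> = a k * b (e k) z + (\<Sum>k\<in>I. a k * b (e k) z)"
    using insert symmetric_bilinear_on_tscale[OF b ek z] by simp
  finally show ?case
    using insert by (simp add: tadd_def tscale_def)
qed

text \<open>Read in a chart d around p, this is linearity of the Jacobian from c to d applied to the
  standard expansion of \<open>u c\<close>; in all other charts both sides have the default value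
  0.\<close>

lemma tangent_space_coord_expansion:
  assumes M: "smooth_4manifold X A" and c: "c \<in> A" "p \<in> fst c" and u: "u \<in> tangent_space A p"
  shows "u = (\<lambda>d. \<Sum>k\<in>UNIV. (u c $ k) *\<^sub>R coord_vector A c p k d)"
proof
  fix d
  show "u d = (\<Sum>k\<in>UNIV. (u c $ k) *\<^sub>R coord_vector A c p k d)"
  proof (cases "d \<in> A \<and> p \<in> fst d")
    case True
    then have lin: "linear (jacobian c d p)"
      using linear_jacobian[OF M c(1) _ c(2)] by blast
    have "u d = jacobian c d p (u c)"
      using tangent_spaceD(1)[OF u] c True by simp
    also have "u c = (\<Sum>k\<in>UNIV. (u c $ k) *\<^sub>R axis k 1)"
      by (simp add: basis_expansion flip: scalar_mult_eq_scaleR)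
    also have "jacobian c d p \<dots> = (\<Sum>k\<in>UNIV. (u c $ k) *\<^sub>R jacobian c d p (axis k 1))"
      by (simp add: linear_sum[OF lin] linear_scale[OF lin])
    finally show ?thesis
      using True by (simp add: coord_vector_def)
  next
    case False
    then show ?thesis
      using tangent_spaceD(2)[OF u False] by (simp add: coord_vector_def del: de_Morgan_conj)
  qed
qed

text \<open>Expanding the orthonormal frame e in the coordinate vectors gives a matrix E with E G
  E^T diagonal with entries 1 or -1. Its determinant is nonzero, and multiplicativity passes this to
  G without first showing that e is a basis.\<close>

lemma det_metric_matrix_nonzero:
  fixes g :: "'m tensor2"
  assumes "lorentzian_4manifold X A g" and c: "c \<in> A" "p \<in> fst c"
  shows "det (metric_matrix A g c (snd c p)) \<noteq> 0"
proof -
  have M: "smooth_4manifold X A" and L: "lorentzian_metric X A g"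
    using assms(1) by (auto simp: lorentzian_4manifold_def)
  have ch: "is_chart X c" and p: "p \<in> topspace X"
    using smooth_4manifoldD(2)[OF M c(1)] is_chartD(4) c(2) by blast+
  have b: "symmetric_bilinear_on (tangent_space A p) (g p)"
    using L p by (simp add: lorentzian_metric_def)
  obtain s and e :: "4 \<Rightarrow> 'm tvec" where s: "s \<in> {1, -1::real}" and e: "\<And>i. e i \<in> tangent_space A p"
    and ge: "\<And>i j. g p (e i) (e j) = s * (if i \<noteq> j then 0 else if i = 0 then -1 else 1)"
    using L p unfolding lorentzian_metric_def by blast
  define G where "G = metric_matrix A g c (snd c p)"
  define E where "E = (\<chi> i. e i c)"
  let ?b = "coord_vector A c p"
  have G: "G $ k $ l = g p (?b k) (?b l)" for k l
    by (simp add: G_def metric_matrix_def chart_inv_apply[OF ch c(2)])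
  have bT: "?b k \<in> tangent_space A p" for k
    by (rule coord_vector_in_tangent_space[OF M c])
  have lin: "g p (e i) z = (\<Sum>k\<in>UNIV. E $ i $ k * g p (?b k) z)" if "z \<in> tangent_space A p" for i z
  proof -
    have "g p (e i) z = g p (\<lambda>d. \<Sum>k\<in>UNIV. (e i c $ k) *\<^sub>R ?b k d) z"
      using tangent_space_coord_expansion[OF M c e[of i]] by (rule arg_cong)
    also have "\<dots> = (\<Sum>k\<in>UNIV. e i c $ k * g p (?b k) z)"
      by (rule symmetric_bilinear_on_sum[OF M b _ _ that]) (simp_all add: bT)
    finally show ?thesis
      by (simp add: E_def)
  qed
  have sym: "g p u w = g p w u" if "u \<in> tangent_space A p" "w \<in> tangent_space A p" for u w
    using b that unfolding symmetric_bilinear_on_def by blast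
  have "g p (e i) (e j) = (E ** (G ** transpose E)) $ i $ j" for i j
  proof -
    have "g p (?b k) (e j) = (\<Sum>l\<in>UNIV. G $ k $ l * E $ j $ l)" for k
      by (simp add: sym[OF bT e] lin[OF bT] sym[OF bT bT, of _ k] G mult.commute)
    then show ?thesis
      using lin[OF e, of i j] by (simp add: matrix_matrix_mult_def transpose_def)
  qed
  moreover have "det (\<chi> i j. g p (e i) (e j)) \<noteq> 0"
  proof -
    have "det (\<chi> i j. g p (e i) (e j)) = (\<Prod>i\<in>UNIV. g p (e i) (e i))"
      by (subst det_diagonal) (auto simp: ge)
    also have "\<dots> \<noteq> 0"
      using s by (auto simp: ge)
    finally show ?thesis .
  qed
  ultimately have "det (E ** (G ** transpose E)) \<noteq> 0"
    by simp
  then show ?thesis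
    by (simp add: det_mul G_def)
qed

lemma lip_bdd_christoffel:
  assumes "lorentzian_4manifold X A g" and c: "c \<in> A"
    and K: "K \<subseteq> snd c ` fst c" "compact K" "convex K"
  shows "lip_bdd K (\<lambda>x. christoffel A g c x k i j)"
proof -
  let ?G = "metric_matrix A g c" and ?S = "snd c ` fst c"
  have "smooth_on ?G ?S"
    using assms by (auto simp: lorentzian_4manifold_def lorentzian_metric_def)
  then have C2: "C_diff_on (Suc (Suc 0)) ?G ?S" and C1: "C_diff_on (Suc 0) ?G ?S"
    unfolding smooth_on_def by blast+
  have comp: "bounded_linear (\<lambda>M::real^4^4. M $ i $ j)" for i j
    using bounded_linear_compose[OF bounded_linear_vec_nth bounded_linear_vec_nth] .
  have G: "lip_bdd K (\<lambda>x. ?G x $ i $ j)" for i j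
    by (rule lip_bdd_bounded_linear[OF comp lip_bdd_C_diff_on_1[OF C1 K]])
  have D: "lip_bdd K (\<lambda>x. metric_deriv A g c x k i j)" for k i j
  proof -
    have "C_diff_on (Suc 0) (\<lambda>x. frechet_derivative ?G (at x) (axis k 1)) ?S"
      using C2 by simp
    then have "lip_bdd K (\<lambda>x. frechet_derivative ?G (at x) (axis k 1) $ i $ j)"
      by (rule lip_bdd_bounded_linear[OF comp lip_bdd_C_diff_on_1[OF _ K]])
    \<comment> \<open>\<open>metric_deriv\<close> differentiates a single entry, while smoothness is
      assumed for the matrix-valued map; taking an entry is bounded linear and so commutes with the
      derivative.\<close>
    moreover have "metric_deriv A g c x k i j = frechet_derivative ?G (at x) (axis k 1) $ i $ j"
      if "x \<in> K" for x
    proof -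
      have "(?G has_derivative frechet_derivative ?G (at x)) (at x)"
        using C1 K(1) that by (auto simp: frechet_derivative_works)
      then have "((\<lambda>y. ?G y $ i $ j) has_derivative (\<lambda>v. frechet_derivative ?G (at x) v $ i $ j)) (at x)"
        by (rule bounded_linear.has_derivative[OF comp])
      then show ?thesis
        by (simp add: metric_deriv_def flip: frechet_derivative_at)
    qed
    ultimately show ?thesis
      by (rule iffD2[OF lip_bdd_cong, rotated])
  qed
  have "det (?G x) \<noteq> 0" if "x \<in> K" for x
    using K(1) that det_metric_matrix_nonzero[OF assms(1) c] by blast
  then show ?thesis
    unfolding christoffel_def
    by (intro lip_bdd_mult lip_bdd_sum lip_bdd_add lip_bdd_diff lip_bdd_const D
        lip_bdd_matrix_inv G K)
qed

text \<open>The geodesic equation as a first-order system for position and velocity.\<close>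
definition geodesic_field ::
    "'m chart set \<Rightarrow> 'm tensor2 \<Rightarrow> 'm chart \<Rightarrow> (real^4) \<times> (real^4) \<Rightarrow> (real^4) \<times> (real^4)" where
  "geodesic_field A g c z =
     (snd z, \<chi> k. - (\<Sum>i\<in>UNIV. \<Sum>j\<in>UNIV. christoffel A g c (fst z) k i j * snd z $ i * snd z $ j))"

text \<open>The field is quadratic in the velocity, so a Lipschitz bound requires velocities from a
  bounded set, just as the Christoffel symbols require positions from a compact convex one.\<close>

lemma lip_bdd_geodesic_field:
  assumes "lorentzian_4manifold X A g" "c \<in> A"
    and K: "K \<subseteq> snd c ` fst c" "compact K" "convex K" "bounded K'"
  shows "lip_bdd (K \<times> K') (geodesic_field A g c)"
proof -
  have "lip_bdd (K \<times> K') (\<lambda>z. snd z $ i)" for i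
    by (rule lip_bdd_bounded_linear[OF bounded_linear_vec_nth lip_bdd_snd[OF K(4)]])
  then show ?thesis
    unfolding geodesic_field_def[abs_def]
    by (intro lip_bdd_Pair lip_bdd_snd lip_bdd_vec lip_bdd_minus lip_bdd_sum lip_bdd_mult
        lip_bdd_fst lip_bdd_christoffel[OF assms(1,2)] K)
qed

section \<open>Smooth curves and affine reparametrisation\<close>

text \<open>A connected set with more than one point has no isolated points. This makes derivatives
  within J unique, also at endpoints, so that \<open>deriv_within\<close> can be computed.\<close>

lemma proper_interval_islimpt:
  assumes "proper_interval J" "t \<in> J"
  shows "at t within J \<noteq> bot"
proof -
  have "connected J" "J \<noteq> {a}" for a
    using assms(1) by (auto simp: proper_interval_def is_interval_connected_1)
  then show ?thesis
    using connected_imp_perfect[OF _ assms(2)] by (simp add: trivial_limit_within)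
qed

lemma deriv_withinI:
  assumes "proper_interval J" "t \<in> J" "(f has_vector_derivative v) (at t within J)"
  shows "deriv_within J f t = v"
  unfolding deriv_within_def
  by (rule vector_derivative_within[OF proper_interval_islimpt[OF assms(1,2)] assms(3)])

lemma smooth_curveD:
  assumes "smooth_curve X A J \<gamma>"
  shows "proper_interval J" "continuous_map (top_of_set J) X \<gamma>"
    "c \<in> A \<Longrightarrow> t \<in> J \<Longrightarrow> \<gamma> t \<in> fst c \<Longrightarrow>
      ((deriv_within J ^^ n) (snd c \<circ> \<gamma>) has_vector_derivative
        (deriv_within J ^^ Suc n) (snd c \<circ> \<gamma>) t) (at t within J)"
proof -
  show "proper_interval J" "continuous_map (top_of_set J) X \<gamma>"
    using assms unfolding smooth_curve_def by blast+
  assume "c \<in> A" "t \<in> J" "\<gamma> t \<in> fst c"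
  then have "(deriv_within J ^^ n) (snd c \<circ> \<gamma>) differentiable (at t within J)"
    using assms unfolding smooth_curve_def by blast
  then show "((deriv_within J ^^ n) (snd c \<circ> \<gamma>) has_vector_derivative
        (deriv_within J ^^ Suc n) (snd c \<circ> \<gamma>) t) (at t within J)"
    by (simp add: vector_derivative_works deriv_within_def)
qed

lemma continuous_map_real_nbhd:
  fixes \<gamma> :: "real \<Rightarrow> 'm"
  assumes "continuous_map (top_of_set J) X \<gamma>" "openin X U" "t \<in> J" "\<gamma> t \<in> U"
  obtains d where "d > 0" "\<And>s. s \<in> J \<Longrightarrow> dist s t < d \<Longrightarrow> \<gamma> s \<in> U"
proof -
  have "openin (top_of_set J) {s \<in> J. \<gamma> s \<in> U}"
    using openin_continuous_map_preimage[OF assms(1,2)] by simp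
  then obtain d where "d > 0" "\<forall>s\<in>J. dist s t < d \<longrightarrow> s \<in> {s \<in> J. \<gamma> s \<in> U}"
    using assms(3,4) unfolding openin_euclidean_subtopology_iff by blast
  then show thesis
    using that by blast
qed

text \<open>The compatibility of components is the chain rule for the coordinate change. The
  factorisation of the curve through c holds only at times near t, which suffices for the derivative
  at t.\<close>

lemma velocity_in_tangent_space:
  assumes M: "smooth_4manifold X A" and sm: "smooth_curve X A J \<gamma>" and t: "t \<in> J"
  shows "velocity A J \<gamma> t \<in> tangent_space A (\<gamma> t)"
proof (rule tangent_spaceI)
  show "velocity A J \<gamma> t c = 0" if "\<not> (c \<in> A \<and> \<gamma> t \<in> fst c)" for c
    using that by (simp add: velocity_def del: de_Morgan_conj)
  fix c d assume c: "c \<in> A" "\<gamma> t \<in> fst c" and d: "d \<in> A" "\<gamma> t \<in> fst d"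
  have ch: "is_chart X c"
    by (rule smooth_4manifoldD(2)[OF M c(1)])
  obtain r where r: "r > 0" "\<And>s. s \<in> J \<Longrightarrow> dist s t < r \<Longrightarrow> \<gamma> s \<in> fst c"
    using continuous_map_real_nbhd[OF smooth_curveD(2)[OF sm] is_chartD(1)[OF ch] t c(2)] by blast
  let ?v = "deriv_within J (snd c \<circ> \<gamma>) t"
  have "(snd c \<circ> \<gamma> has_vector_derivative ?v) (at t within J)"
    using smooth_curveD(3)[OF sm c(1) t c(2), of 0] by simp
  then have "(snd c \<circ> \<gamma> has_derivative (\<lambda>h. h *\<^sub>R ?v)) (at t within J)"
    by (simp only: has_vector_derivative_def)
  moreover have "(transition c d has_derivative jacobian c d (\<gamma> t)) (at ((snd c \<circ> \<gamma>) t))"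
    using transition_has_derivative[OF M c(1) d(1) c(2) d(2)] by simp
  ultimately have "((\<lambda>s. transition c d ((snd c \<circ> \<gamma>) s)) has_derivative
      (\<lambda>h. jacobian c d (\<gamma> t) (h *\<^sub>R ?v))) (at t within J)"
    by (rule has_derivative_compose)
  then have "((\<lambda>s. transition c d ((snd c \<circ> \<gamma>) s)) has_vector_derivative jacobian c d (\<gamma> t) ?v)
      (at t within J)"
    by (simp only: has_vector_derivative_def linear_scale[OF linear_jacobian[OF M c(1) d(1) c(2) d(2)]])
  then have "(snd d \<circ> \<gamma> has_vector_derivative jacobian c d (\<gamma> t) ?v) (at t within J)"
    by (rule has_vector_derivative_transform_within[OF _ r(1) t]) (simp add: transition_apply[OF ch] r(2))
  then have "deriv_within J (snd d \<circ> \<gamma>) t = jacobian c d (\<gamma> t) ?v"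
    by (rule deriv_withinI[OF smooth_curveD(1)[OF sm] t])
  then show "velocity A J \<gamma> t d = jacobian c d (\<gamma> t) (velocity A J \<gamma> t c)"
    using c d by (simp add: velocity_def)
qed

text \<open>Needed because the tangent vector v of the worldline is taken within its whole domain,
  while the geodesic equation is known only within the segment.\<close>

lemma velocity_subset:
  assumes "smooth_curve X A J' \<gamma>" "proper_interval J" "J \<subseteq> J'" "t \<in> J"
  shows "velocity A J \<gamma> t = velocity A J' \<gamma> t"
proof
  fix c
  show "velocity A J \<gamma> t c = velocity A J' \<gamma> t c"
  proof (cases "c \<in> A \<and> \<gamma> t \<in> fst c")
    case True
    then have "(snd c \<circ> \<gamma> has_vector_derivative deriv_within J' (snd c \<circ> \<gamma>) t) (at t within J')"
      using smooth_curveD(3)[OF assms(1), of c t 0] assms(3,4) by auto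
    then have "deriv_within J (snd c \<circ> \<gamma>) t = deriv_within J' (snd c \<circ> \<gamma>) t"
      using assms by (intro deriv_withinI has_vector_derivative_within_subset[OF _ assms(3)])
    then show ?thesis by (simp add: velocity_def)
  next
    case False
    then show ?thesis by (simp add: velocity_def del: de_Morgan_conj)
  qed
qed

section \<open>Affine reparametrisation\<close>

lemma proper_interval_affine_vimage:
  assumes "proper_interval J" "s \<noteq> 0"
  shows "proper_interval {\<tau>. t0 + s * \<tau> \<in> J}"
proof -
  obtain a b where ab: "a \<in> J" "b \<in> J" "a < b"
    using assms(1) by (auto simp: proper_interval_def)
  have J: "convex J"
    using assms(1) by (simp add: proper_interval_def is_interval_convex_1)
  have "convex {\<tau>. t0 + s * \<tau> \<in> J}"
  proof (rule convexI)
    fix x y u v :: real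
    assume "x \<in> {\<tau>. t0 + s * \<tau> \<in> J}" "y \<in> {\<tau>. t0 + s * \<tau> \<in> J}" and uv: "0 \<le> u" "0 \<le> v" "u + v = 1"
    then have "u *\<^sub>R (t0 + s * x) + v *\<^sub>R (t0 + s * y) \<in> J"
      using convexD[OF J] by blast
    moreover have "u *\<^sub>R (t0 + s * x) + v *\<^sub>R (t0 + s * y) = (u + v) * t0 + s * (u * x + v * y)"
      by (simp add: algebra_simps)
    ultimately show "u *\<^sub>R x + v *\<^sub>R y \<in> {\<tau>. t0 + s * \<tau> \<in> J}"
      using uv(3) by simp
  qed
  then have "is_interval {\<tau>. t0 + s * \<tau> \<in> J}"
    by (simp add: is_interval_convex_1)
  moreover have "(a - t0) / s \<in> {\<tau>. t0 + s * \<tau> \<in> J}" "(b - t0) / s \<in> {\<tau>. t0 + s * \<tau> \<in> J}"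
    using ab assms(2) by auto
  \<comment> \<open>Only distinctness is recorded: for negative s the preimages come in reversed
    order.\<close>
  moreover have "(a - t0) / s \<noteq> (b - t0) / s"
    using ab assms(2) by auto
  ultimately show ?thesis
    unfolding proper_interval_def by (meson linorder_neqE)
qed

lemma deriv_within_affine:
  fixes t0 s \<tau> :: real
  assumes sm: "smooth_curve X A J \<gamma>" and "s \<noteq> 0" and c: "c \<in> A" "is_chart X c"
  defines "J0 \<equiv> {\<tau>. t0 + s * \<tau> \<in> J}"
  assumes "\<tau> \<in> J0" "\<gamma> (t0 + s * \<tau>) \<in> fst c"
  shows "(deriv_within J0 ^^ n) (snd c \<circ> (\<lambda>\<tau>. \<gamma> (t0 + s * \<tau>))) \<tau> =
      s ^ n *\<^sub>R (deriv_within J ^^ n) (snd c \<circ> \<gamma>) (t0 + s * \<tau>)"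
    and "(deriv_within J0 ^^ n) (snd c \<circ> (\<lambda>\<tau>. \<gamma> (t0 + s * \<tau>))) differentiable (at \<tau> within J0)"
proof -
  let ?F = "\<lambda>n. (deriv_within J0 ^^ n) (snd c \<circ> (\<lambda>\<tau>. \<gamma> (t0 + s * \<tau>)))"
  let ?f = "\<lambda>n. (deriv_within J ^^ n) (snd c \<circ> \<gamma>)"
  have pr: "proper_interval J0"
    unfolding J0_def by (rule proper_interval_affine_vimage[OF smooth_curveD(1)[OF sm] assms(2)])
  \<comment> \<open>The derivative of order n + 1 at one time requires the formula for order n at
    all nearby times in the chart. Isolating this step serves both the induction for the formula and
    the differentiability claim.\<close>
  have step: "(?F n has_vector_derivative s ^ Suc n *\<^sub>R ?f (Suc n) (t0 + s * \<tau>)) (at \<tau> within J0)"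
    if IH: "\<And>\<tau>. \<tau> \<in> J0 \<Longrightarrow> \<gamma> (t0 + s * \<tau>) \<in> fst c \<Longrightarrow> ?F n \<tau> = s ^ n *\<^sub>R ?f n (t0 + s * \<tau>)"
      and \<tau>: "\<tau> \<in> J0" "\<gamma> (t0 + s * \<tau>) \<in> fst c" for n \<tau>
  proof -
    have tJ: "t0 + s * \<tau> \<in> J"
      using \<tau>(1) by (simp add: J0_def)
    obtain r where r: "r > 0" "\<And>u. u \<in> J \<Longrightarrow> dist u (t0 + s * \<tau>) < r \<Longrightarrow> \<gamma> u \<in> fst c"
      using continuous_map_real_nbhd[OF smooth_curveD(2)[OF sm] is_chartD(1)[OF c(2)] tJ \<tau>(2)] by blast
    have "((\<lambda>\<tau>. t0 + s * \<tau>) has_vector_derivative s) (at \<tau> within J0)"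
      by (auto intro!: derivative_eq_intros)
    moreover have "(?f n has_vector_derivative ?f (Suc n) (t0 + s * \<tau>))
        (at (t0 + s * \<tau>) within (\<lambda>\<tau>. t0 + s * \<tau>) ` J0)"
      by (rule has_vector_derivative_within_subset[OF smooth_curveD(3)[OF sm c(1) tJ \<tau>(2)]])
        (auto simp: J0_def)
    ultimately have "(?f n \<circ> (\<lambda>\<tau>. t0 + s * \<tau>) has_vector_derivative s *\<^sub>R ?f (Suc n) (t0 + s * \<tau>)) (at \<tau> within J0)"
      by (rule vector_diff_chain_within)
    then have "((\<lambda>\<tau>. s ^ n *\<^sub>R (?f n \<circ> (\<lambda>\<tau>. t0 + s * \<tau>)) \<tau>) has_vector_derivative
        s ^ n *\<^sub>R (s *\<^sub>R ?f (Suc n) (t0 + s * \<tau>))) (at \<tau> within J0)"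
      by (rule bounded_linear.has_vector_derivative[OF bounded_linear_scaleR_right])
    then have *: "((\<lambda>\<tau>. s ^ n *\<^sub>R ?f n (t0 + s * \<tau>)) has_vector_derivative
        s ^ Suc n *\<^sub>R ?f (Suc n) (t0 + s * \<tau>)) (at \<tau> within J0)"
      by (simp add: o_def mult.commute)
    \<comment> \<open>The map stretches distances by |s|, so this radius keeps the image within
      distance r, where the curve is in the chart.\<close>
    have "0 < r / \<bar>s\<bar>" using r(1) assms(2) by simp
    then show ?thesis
    proof (rule has_vector_derivative_transform_within[OF * _ \<tau>(1)])
      fix \<sigma> assume \<sigma>: "\<sigma> \<in> J0" "dist \<sigma> \<tau> < r / \<bar>s\<bar>"
      have "dist (t0 + s * \<sigma>) (t0 + s * \<tau>) = \<bar>s\<bar> * dist \<sigma> \<tau>"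
        by (simp add: dist_real_def flip: abs_mult right_diff_distrib)
      also have "\<dots> < r"
        using \<sigma>(2) assms(2) by (simp add: field_simps)
      finally show "s ^ n *\<^sub>R ?f n (t0 + s * \<sigma>) = ?F n \<sigma>"
        using IH[OF \<sigma>(1)] r(2)[of "t0 + s * \<sigma>"] \<sigma>(1) by (simp add: J0_def)
    qed
  qed
  have F: "?F n \<tau> = s ^ n *\<^sub>R ?f n (t0 + s * \<tau>)" if "\<tau> \<in> J0" "\<gamma> (t0 + s * \<tau>) \<in> fst c" for n \<tau>
    using that
  proof (induction n arbitrary: \<tau>)
    case 0
    then show ?case by simp
  next
    case (Suc n)
    have "?F (Suc n) = deriv_within J0 (?F n)"
      by simp
    then show ?case
      using deriv_withinI[OF pr Suc.prems(1) step[OF Suc.IH Suc.prems]] by (simp only:)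
  qed
  then show "?F n \<tau> = s ^ n *\<^sub>R ?f n (t0 + s * \<tau>)"
    using assms by blast
  show "?F n differentiable (at \<tau> within J0)"
    using step[OF F, of \<tau> n] assms differentiableI_vector by blast
qed

lemma is_geodesicD:
  assumes "is_geodesic X A g J \<gamma>"
  shows "smooth_curve X A J \<gamma>"
    "c \<in> A \<Longrightarrow> t \<in> J \<Longrightarrow> \<gamma> t \<in> fst c \<Longrightarrow> deriv_within J (deriv_within J (snd c \<circ> \<gamma>)) t $ k +
           (\<Sum>i\<in>UNIV. \<Sum>j\<in>UNIV. christoffel A g c (snd c (\<gamma> t)) k i j *
              deriv_within J (snd c \<circ> \<gamma>) t $ i * deriv_within J (snd c \<circ> \<gamma>) t $ j) = 0"
  using assms unfolding is_geodesic_def by blast+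

lemma geodesic_affine:
  fixes t0 s \<tau> :: real
  assumes M: "smooth_4manifold X A" and geo: "is_geodesic X A g J \<gamma>" and "s \<noteq> 0"
  defines "J0 \<equiv> {\<tau>. t0 + s * \<tau> \<in> J}"
  shows "is_geodesic X A g J0 (\<lambda>\<tau>. \<gamma> (t0 + s * \<tau>))"
    and "\<tau> \<in> J0 \<Longrightarrow> velocity A J0 (\<lambda>\<tau>. \<gamma> (t0 + s * \<tau>)) \<tau> = tscale s (velocity A J \<gamma> (t0 + s * \<tau>))"
proof -
  let ?\<alpha> = "\<lambda>\<tau>. \<gamma> (t0 + s * \<tau>)"
  note sm = is_geodesicD(1)[OF geo]
  note aff = deriv_within_affine[OF sm assms(3) _ smooth_4manifoldD(2)[OF M], where ?t0.0 = t0, folded J0_def]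
  have d1: "deriv_within J0 (snd c \<circ> ?\<alpha>) \<tau> = s *\<^sub>R deriv_within J (snd c \<circ> \<gamma>) (t0 + s * \<tau>)"
    and d2: "deriv_within J0 (deriv_within J0 (snd c \<circ> ?\<alpha>)) \<tau> =
      s\<^sup>2 *\<^sub>R deriv_within J (deriv_within J (snd c \<circ> \<gamma>)) (t0 + s * \<tau>)"
    if "c \<in> A" "\<tau> \<in> J0" "?\<alpha> \<tau> \<in> fst c" for c \<tau>
    using aff(1)[OF that(1,1-3), of 1] aff(1)[OF that(1,1-3), of "Suc (Suc 0)"]
    by (simp_all add: power2_eq_square)
  have "continuous_on J0 (\<lambda>\<tau>. t0 + s * \<tau>)"
    by (intro continuous_intros)
  then have "continuous_map (top_of_set J0) (top_of_set J) (\<lambda>\<tau>. t0 + s * \<tau>)"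
    by (auto simp: J0_def continuous_map_in_subtopology)
  from continuous_map_compose[OF this smooth_curveD(2)[OF sm]]
  have "continuous_map (top_of_set J0) X ?\<alpha>"
    by (simp add: o_def)
  then have "smooth_curve X A J0 ?\<alpha>"
    unfolding smooth_curve_def
    using aff(2) proper_interval_affine_vimage[OF smooth_curveD(1)[OF sm] assms(3), of t0, folded J0_def]
    by blast
  moreover have "deriv_within J0 (deriv_within J0 (snd c \<circ> ?\<alpha>)) \<tau> $ k +
           (\<Sum>i\<in>UNIV. \<Sum>j\<in>UNIV. christoffel A g c (snd c (?\<alpha> \<tau>)) k i j *
              deriv_within J0 (snd c \<circ> ?\<alpha>) \<tau> $ i * deriv_within J0 (snd c \<circ> ?\<alpha>) \<tau> $ j) = 0"
    if "c \<in> A" "\<tau> \<in> J0" "?\<alpha> \<tau> \<in> fst c" for c \<tau> k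
  proof -
    have tJ: "t0 + s * \<tau> \<in> J"
      using that by (simp add: J0_def)
    \<comment> \<open>The acceleration scales by the square of s, and so does the Christoffel term,
      being quadratic in the velocity; the whole equation is just multiplied by that factor.\<close>
    have "?thesis \<longleftrightarrow> s\<^sup>2 * (deriv_within J (deriv_within J (snd c \<circ> \<gamma>)) (t0 + s * \<tau>) $ k +
           (\<Sum>i\<in>UNIV. \<Sum>j\<in>UNIV. christoffel A g c (snd c (\<gamma> (t0 + s * \<tau>))) k i j *
              deriv_within J (snd c \<circ> \<gamma>) (t0 + s * \<tau>) $ i * deriv_within J (snd c \<circ> \<gamma>) (t0 + s * \<tau>) $ j)) = 0"
      unfolding d1[OF that] d2[OF that]
      by (simp add: distrib_left sum_distrib_left power2_eq_square mult_ac)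
    then show ?thesis
      using is_geodesicD(2)[OF geo that(1) tJ that(3)] by simp
  qed
  ultimately show "is_geodesic X A g J0 ?\<alpha>"
    unfolding is_geodesic_def by blast
  show "velocity A J0 ?\<alpha> \<tau> = tscale s (velocity A J \<gamma> (t0 + s * \<tau>))" if "\<tau> \<in> J0" for \<tau>
  proof
    show "velocity A J0 ?\<alpha> \<tau> c = tscale s (velocity A J \<gamma> (t0 + s * \<tau>)) c" for c
      using d1[OF _ that, of c] by (simp add: velocity_def tscale_def)
  qed
qed

section \<open>Uniqueness of geodesics and the exponential map\<close>

lemma geodesic_has_vector_derivative:
  assumes geo: "is_geodesic X A g J \<gamma>" and t: "c \<in> A" "t \<in> J" "\<gamma> t \<in> fst c"
  shows "((\<lambda>t. (snd c (\<gamma> t), deriv_within J (snd c \<circ> \<gamma>) t)) has_vector_derivative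
      geodesic_field A g c (snd c (\<gamma> t), deriv_within J (snd c \<circ> \<gamma>) t)) (at t within J)"
proof -
  note sm = is_geodesicD(1)[OF geo]
  have "((\<lambda>t. snd c (\<gamma> t)) has_vector_derivative deriv_within J (snd c \<circ> \<gamma>) t) (at t within J)"
    using smooth_curveD(3)[OF sm t, of 0] by (simp add: o_def)
  moreover have "(deriv_within J (snd c \<circ> \<gamma>) has_vector_derivative
      deriv_within J (deriv_within J (snd c \<circ> \<gamma>)) t) (at t within J)"
    using smooth_curveD(3)[OF sm t, of 1] by simp
  moreover have "deriv_within J (deriv_within J (snd c \<circ> \<gamma>)) t =
      (\<chi> k. - (\<Sum>i\<in>UNIV. \<Sum>j\<in>UNIV. christoffel A g c (snd c (\<gamma> t)) k i j *
        deriv_within J (snd c \<circ> \<gamma>) t $ i * deriv_within J (snd c \<circ> \<gamma>) t $ j))"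
    using is_geodesicD(2)[OF geo t] by (simp add: vec_eq_iff eq_neg_iff_add_eq_0)
  ultimately show ?thesis
    unfolding geodesic_field_def fst_conv snd_conv by (simp only: has_vector_derivative_Pair)
qed

lemma geodesics_agree_locally:
  assumes lor: "lorentzian_4manifold X A g" and c: "c \<in> A"
    and geo: "is_geodesic X A g J1 \<gamma>1" "is_geodesic X A g J2 \<gamma>2"
    and I: "convex I" "compact I" "I \<subseteq> J1" "I \<subseteq> J2"
    and t0: "t0 \<in> I" "\<gamma>1 t0 \<in> fst c" "\<gamma>1 t0 = \<gamma>2 t0"
      "deriv_within J1 (snd c \<circ> \<gamma>1) t0 = deriv_within J2 (snd c \<circ> \<gamma>2) t0"
  obtains d where "d > 0" "\<And>t. t \<in> I \<Longrightarrow> dist t t0 < d \<Longrightarrow>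
      \<gamma>1 t = \<gamma>2 t \<and> deriv_within J1 (snd c \<circ> \<gamma>1) t = deriv_within J2 (snd c \<circ> \<gamma>2) t"
proof -
  have ch: "is_chart X c"
    using lor c smooth_4manifoldD(2) unfolding lorentzian_4manifold_def by blast
  define z1 where "z1 = (\<lambda>t. (snd c (\<gamma>1 t), deriv_within J1 (snd c \<circ> \<gamma>1) t))"
  define z2 where "z2 = (\<lambda>t. (snd c (\<gamma>2 t), deriv_within J2 (snd c \<circ> \<gamma>2) t))"
  have z0: "z1 t0 = z2 t0"
    using t0 by (simp add: z1_def z2_def)
  have d1: "(z1 has_vector_derivative geodesic_field A g c (z1 t)) (at t within I)"
    if "t \<in> I" "\<gamma>1 t \<in> fst c" for t
    using has_vector_derivative_within_subset[OF geodesic_has_vector_derivative[OF geo(1) c _ that(2)] I(3)]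
      that(1) I(3) unfolding z1_def by blast
  have d2: "(z2 has_vector_derivative geodesic_field A g c (z2 t)) (at t within I)"
    if "t \<in> I" "\<gamma>2 t \<in> fst c" for t
    using has_vector_derivative_within_subset[OF geodesic_has_vector_derivative[OF geo(2) c _ that(2)] I(4)]
      that(1) I(4) unfolding z2_def by blast
  have cont: "continuous (at t0 within I) z1" "continuous (at t0 within I) z2"
    using d1 d2 t0 has_vector_derivative_continuous by metis+
  obtain r where r: "r > 0" "cball (fst (z1 t0)) r \<subseteq> snd c ` fst c"
    using is_chartD(2)[OF ch] t0(2) unfolding open_contains_cball z1_def by force
  \<comment> \<open>The first radius keeps positions inside the chart image; the velocity radius 1
    is arbitrary. Closed balls provide the compactness and convexity behind the Lipschitz
    bound.\<close>
  define K where "K = cball (fst (z1 t0)) r \<times> cball (snd (z1 t0)) 1"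
  have "lip_bdd K (geodesic_field A g c)"
    unfolding K_def by (rule lip_bdd_geodesic_field[OF lor c r(2)]) simp_all
  then obtain B L where L: "B \<ge> 0" "L \<ge> 0" "\<And>x. x \<in> K \<Longrightarrow> norm (geodesic_field A g c x) \<le> B"
    "\<And>x y. x \<in> K \<Longrightarrow> y \<in> K \<Longrightarrow> norm (geodesic_field A g c x - geodesic_field A g c y) \<le> L * dist x y"
    by (rule lip_bddE) (rule that)
  have K: "z \<in> K" if "dist z (z1 t0) < min r 1" for z
  proof -
    have "dist (fst z) (fst (z1 t0)) < r" "dist (snd z) (snd (z1 t0)) < 1"
      using that dist_fst_le[of z "z1 t0"] dist_snd_le[of z "z1 t0"] by linarith+
    then show ?thesis
      by (simp add: K_def mem_Times_iff dist_commute)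
  qed
  have m: "min r 1 > 0"
    using r(1) by simp
  obtain e1 where e1: "e1 > 0" "\<And>t. t \<in> I \<Longrightarrow> dist t t0 < e1 \<Longrightarrow> z1 t \<in> K"
    using cont(1) m K unfolding continuous_within_eps_delta by meson
  obtain e2 where e2: "e2 > 0" "\<And>t. t \<in> I \<Longrightarrow> dist t t0 < e2 \<Longrightarrow> z2 t \<in> K"
    using cont(2) m K unfolding continuous_within_eps_delta z0 by meson
  \<comment> \<open>Coordinates in K do not place the point in the chart, since \<open>snd c\<close>
    is arbitrary off \<open>fst c\<close>; chart membership needs radii of its own.\<close>
  obtain e3 where e3: "e3 > 0" "\<And>t. t \<in> J1 \<Longrightarrow> dist t t0 < e3 \<Longrightarrow> \<gamma>1 t \<in> fst c"
    using continuous_map_real_nbhd[OF smooth_curveD(2)[OF is_geodesicD(1)[OF geo(1)]] is_chartD(1)[OF ch]]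
      t0(1,2) I(3) by blast
  obtain e4 where e4: "e4 > 0" "\<And>t. t \<in> J2 \<Longrightarrow> dist t t0 < e4 \<Longrightarrow> \<gamma>2 t \<in> fst c"
    using continuous_map_real_nbhd[OF smooth_curveD(2)[OF is_geodesicD(1)[OF geo(2)]] is_chartD(1)[OF ch]]
      t0(1-3) I(4) by (metis subsetD)
  \<comment> \<open>Halving gives strict inequalities on the closed ball of radius d. The last term
    ensures d L < 1, with L + 1 in the denominator to allow L = 0.\<close>
  define d where "d = min (min (min e1 e2) (min e3 e4) / 2) (1 / (2 * (L + 1)))"
  have d: "d > 0" "d < e1" "d < e2" "d < e3" "d < e4" "d \<le> 1 / (2 * (L + 1))"
    using e1(1) e2(1) e3(1) e4(1) L(2) unfolding d_def by auto
  define I' where "I' = I \<inter> cball t0 d"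
  have "d * L \<le> 1 / (2 * (L + 1)) * L"
    using d(6) L(2) by (rule mult_right_mono)
  also have "\<dots> < 1"
    using L(2) by (simp add: field_simps)
  finally have dL: "d * L < 1" .
  have I': "convex I'" "compact I'" "t0 \<in> I'" "I' \<subseteq> I"
    and dist_I': "\<And>t. t \<in> I' \<Longrightarrow> \<bar>t - t0\<bar> \<le> d"
    using I(1,2) t0(1) d(1) by (auto simp: I'_def convex_Int compact_Int_closed dist_real_def)
  have near: "\<gamma>1 t \<in> fst c \<and> \<gamma>2 t \<in> fst c \<and> z1 t \<in> K \<and> z2 t \<in> K" if "t \<in> I'" for t
  proof -
    have "t \<in> I" "dist t t0 < e1" "dist t t0 < e2" "dist t t0 < e3" "dist t t0 < e4"
      using that I'(4) dist_I'[OF that] d by (auto simp: dist_real_def)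
    then show ?thesis
      using e1(2) e2(2) e3(2) e4(2) I(3,4) by blast
  qed
  have eq: "z1 t = z2 t" if "t \<in> I'" for t
  proof (rule ode_local_unique[where F = "geodesic_field A g c" and I = I' and K = K and L = L and d = d and ?t0.0 = t0])
    show "(z1 has_vector_derivative geodesic_field A g c (z1 t)) (at t within I')" if "t \<in> I'" for t
      using has_vector_derivative_within_subset[OF d1 I'(4)] near that I'(4) by blast
    show "(z2 has_vector_derivative geodesic_field A g c (z2 t)) (at t within I')" if "t \<in> I'" for t
      using has_vector_derivative_within_subset[OF d2 I'(4)] near that I'(4) by blast
  qed (use near L(2,4) I' dist_I' dL z0 that in blast)+
  show thesis
  proof (rule that[OF d(1)])
    fix t assume "t \<in> I" "dist t t0 < d"
    then have "t \<in> I'"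
      by (simp add: I'_def dist_commute)
    then show "\<gamma>1 t = \<gamma>2 t \<and> deriv_within J1 (snd c \<circ> \<gamma>1) t = deriv_within J2 (snd c \<circ> \<gamma>2) t"
      using eq near inj_onD[OF is_chartD(3)[OF ch]] unfolding z1_def z2_def by blast
  qed
qed

text \<open>Only the first curve is assumed to stay in the chart. Wherever the curves agree the
  second is there too, so the local result applies at each point of D; connectedness of I then
  leaves no room for the second curve to escape.\<close>

lemma geodesic_unique_in_chart:
  assumes lor: "lorentzian_4manifold X A g" and c: "c \<in> A"
    and geo: "is_geodesic X A g J1 \<gamma>1" "is_geodesic X A g J2 \<gamma>2"
    and I: "convex I" "compact I" "I \<subseteq> J1" "I \<subseteq> J2"
    and t0: "t0 \<in> I" "\<gamma>1 t0 = \<gamma>2 t0"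
      "deriv_within J1 (snd c \<circ> \<gamma>1) t0 = deriv_within J2 (snd c \<circ> \<gamma>2) t0"
    and chart: "\<gamma>1 ` I \<subseteq> fst c" and t: "t \<in> I"
  shows "\<gamma>1 t = \<gamma>2 t"
proof -
  have M: "smooth_4manifold X A"
    using lor unfolding lorentzian_4manifold_def by blast
  have sm: "smooth_curve X A J1 \<gamma>1" "smooth_curve X A J2 \<gamma>2"
    using geo is_geodesicD(1) by blast+
  define v1 where "v1 = deriv_within J1 (snd c \<circ> \<gamma>1)"
  define v2 where "v2 = deriv_within J2 (snd c \<circ> \<gamma>2)"
  define D where "D = {t \<in> I. \<gamma>1 t = \<gamma>2 t \<and> v1 t = v2 t}"
  have "openin (top_of_set I) D"
    unfolding openin_euclidean_subtopology_iff
  proof (intro conjI ballI)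
    fix t assume "t \<in> D"
    then obtain d where "d > 0" "\<And>s. s \<in> I \<Longrightarrow> dist s t < d \<Longrightarrow> \<gamma>1 s = \<gamma>2 s \<and> v1 s = v2 s"
      using geodesics_agree_locally[OF lor c geo I, of t] chart
      unfolding D_def v1_def v2_def by (smt (verit) image_subset_iff mem_Collect_eq)
    then show "\<exists>e>0. \<forall>s\<in>I. dist s t < e \<longrightarrow> s \<in> D"
      unfolding D_def by blast
  qed (simp add: D_def)
  moreover have "openin (top_of_set I) (I - D)"
    unfolding openin_euclidean_subtopology_iff
  proof (intro conjI ballI)
    fix t assume t: "t \<in> I - D"
    show "\<exists>e>0. \<forall>s\<in>I. dist s t < e \<longrightarrow> s \<in> I - D"
    \<comment> \<open>If the positions agree, both points lie in the chart and continuity of the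
      coordinate velocities keeps them different nearby. If the positions differ, the second curve
      may be outside the chart, and the Hausdorff property keeps the points apart instead.\<close>
    proof (cases "\<gamma>1 t = \<gamma>2 t")
      case True
      then have "v1 t \<noteq> v2 t" "\<gamma>1 t \<in> fst c" "\<gamma>2 t \<in> fst c" "t \<in> I"
        using t chart by (auto simp: D_def)
      moreover from this have "(v1 has_vector_derivative deriv_within J1 v1 t) (at t within I)"
          "(v2 has_vector_derivative deriv_within J2 v2 t) (at t within I)"
        using smooth_curveD(3)[OF sm(1) c, of t 1] smooth_curveD(3)[OF sm(2) c, of t 1] I(3,4)
        unfolding v1_def v2_def by (auto intro: has_vector_derivative_within_subset)
      then have "continuous (at t within I) (\<lambda>s. v1 s - v2 s)"
        by (intro continuous_diff has_vector_derivative_continuous)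
      ultimately obtain e where "e > 0" "\<forall>s\<in>I. dist t s < e \<longrightarrow> v1 s - v2 s \<noteq> 0"
        using continuous_within_avoid[of t I "\<lambda>s. v1 s - v2 s" 0] by auto
      then show ?thesis
        unfolding D_def by (intro exI[of _ e]) (auto simp: dist_commute)
    next
      case False
      have cm: "continuous_map (top_of_set I) X \<gamma>1" "continuous_map (top_of_set I) X \<gamma>2"
        using smooth_curveD(2)[OF sm(1)] smooth_curveD(2)[OF sm(2)] I(3,4)
          continuous_map_from_subtopology_mono by blast+
      have "closedin (top_of_set I) {s \<in> topspace (top_of_set I). \<gamma>1 s = \<gamma>2 s}"
        by (rule closedin_continuous_maps_eq[OF smooth_4manifoldD(1)[OF M] cm])
      then have "openin (top_of_set I) (I - {s \<in> I. \<gamma>1 s = \<gamma>2 s})"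
        using openin_diff[OF openin_topspace[of "top_of_set I"]] by simp
      moreover have "t \<in> I - {s \<in> I. \<gamma>1 s = \<gamma>2 s}"
        using t False by blast
      ultimately obtain e where "e > 0" "\<forall>s\<in>I. dist s t < e \<longrightarrow> s \<in> I - {s \<in> I. \<gamma>1 s = \<gamma>2 s}"
        unfolding openin_euclidean_subtopology_iff by blast
      then show ?thesis
        unfolding D_def by blast
    qed
  qed simp
  then have "closedin (top_of_set I) D"
    unfolding closedin_def by (auto simp: D_def)
  moreover have "connected I"
    using I(1) convex_connected by blast
  ultimately have "D = {} \<or> D = I"
    unfolding connected_clopen by blast
  moreover have "t0 \<in> D"
    using t0 by (simp add: D_def v1_def v2_def)
  ultimately show ?thesis
    using t unfolding D_def by blast
qed

text \<open>The given geodesic witnesses existence for the definite description. Any competitor has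
  the same initial velocity in the chart c, so uniqueness on \<open>{0..1}\<close> fixes its
  endpoint.\<close>

lemma exp_map_in_chart:
  assumes lor: "lorentzian_4manifold X A g" and c: "c \<in> A"
    and geo: "is_geodesic X A g J \<gamma>" and J: "{0..1} \<subseteq> J" and chart: "\<gamma> ` {0..1} \<subseteq> fst c"
  shows "velocity A J \<gamma> 0 \<in> exp_domain X A g (\<gamma> 0)"
    and "exp_map X A g (\<gamma> 0) (velocity A J \<gamma> 0) = \<gamma> 1"
proof -
  have M: "smooth_4manifold X A"
    using lor unfolding lorentzian_4manifold_def by blast
  have J0: "0 \<in> J" "\<gamma> 0 \<in> fst c"
    using J chart by auto
  have geo0: "geodesic_from X A g (\<gamma> 0) (velocity A J \<gamma> 0) J \<gamma>"
    using geo J by (simp add: geodesic_from_def)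
  then show "velocity A J \<gamma> 0 \<in> exp_domain X A g (\<gamma> 0)"
    using velocity_in_tangent_space[OF M is_geodesicD(1)[OF geo] J0(1)] unfolding exp_domain_def by blast
  have unique: "q = \<gamma> 1" if *: "geodesic_from X A g (\<gamma> 0) (velocity A J \<gamma> 0) J' \<gamma>'" "\<gamma>' 1 = q" for q J' \<gamma>'
  proof -
    have geo': "is_geodesic X A g J' \<gamma>'" "{0..1} \<subseteq> J'" "\<gamma>' 0 = \<gamma> 0" "velocity A J' \<gamma>' 0 = velocity A J \<gamma> 0"
      using *(1) unfolding geodesic_from_def by blast+
    have "velocity A J \<gamma> 0 c = velocity A J' \<gamma>' 0 c"
      using geo'(4) by simp
    then have "deriv_within J (snd c \<circ> \<gamma>) 0 = deriv_within J' (snd c \<circ> \<gamma>') 0"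
      using c J0(2) geo'(3) by (simp add: velocity_def)
    from geodesic_unique_in_chart[OF lor c geo geo'(1) _ _ J geo'(2) _ _ this chart]
    have "\<gamma> 1 = \<gamma>' 1"
      using geo'(3) by simp
    then show ?thesis
      using *(2) by simp
  qed
  show "exp_map X A g (\<gamma> 0) (velocity A J \<gamma> 0) = \<gamma> 1"
    unfolding exp_map_def using geo0 unique by (intro the_equality) blast+
qed

text \<open>The unoriented \<open>closed_segment\<close> covers both signs of s; negative s is
  unavoidable when t is the right endpoint of J.\<close>

lemma exp_map_scaled_velocity:
  assumes lor: "lorentzian_4manifold X A g" and c: "c \<in> A"
    and geo: "is_geodesic X A g J \<gamma>" and t: "t \<in> J" "t + s \<in> J" and "s \<noteq> 0"
    and chart: "\<gamma> ` closed_segment t (t + s) \<subseteq> fst c"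
  shows "tscale s (velocity A J \<gamma> t) \<in> exp_domain X A g (\<gamma> t)"
    and "exp_map X A g (\<gamma> t) (tscale s (velocity A J \<gamma> t)) = \<gamma> (t + s)"
proof -
  have M: "smooth_4manifold X A"
    using lor unfolding lorentzian_4manifold_def by blast
  have "convex J"
    using smooth_curveD(1)[OF is_geodesicD(1)[OF geo]] by (simp add: proper_interval_def is_interval_convex_1)
  then have seg: "closed_segment t (t + s) \<subseteq> J"
    using t closed_segment_subset by blast
  have mem: "t + s * \<tau> \<in> closed_segment t (t + s)" if "\<tau> \<in> {0..1}" for \<tau>
    using that unfolding in_segment by (intro exI[of _ \<tau>]) (simp add: algebra_simps)
  let ?J = "{\<tau>. t + s * \<tau> \<in> J}"
  have "{0..1} \<subseteq> ?J" "(\<lambda>\<tau>. \<gamma> (t + s * \<tau>)) ` {0..1} \<subseteq> fst c"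
    using mem seg chart by blast+
  note exp = exp_map_in_chart[OF lor c geodesic_affine(1)[OF M geo assms(6), of t] this]
  have "velocity A ?J (\<lambda>\<tau>. \<gamma> (t + s * \<tau>)) 0 = tscale s (velocity A J \<gamma> t)"
    using geodesic_affine(2)[OF M geo assms(6), of 0 t] t(1) by simp
  then show "tscale s (velocity A J \<gamma> t) \<in> exp_domain X A g (\<gamma> t)"
    "exp_map X A g (\<gamma> t) (tscale s (velocity A J \<gamma> t)) = \<gamma> (t + s)"
    using exp by simp_all
qed

text \<open>If f had a single value k on J near t with t removed, continuity would give f t = k as
  well, so f would be constant near t and its derivative zero. Keeping both points away from t makes
  the corresponding scale factors nonzero.\<close>

lemma nonconstant_near_nonzero_derivative:
  assumes J: "proper_interval J" "t \<in> J" and f: "(f has_vector_derivative v) (at t within J)" "v \<noteq> 0"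
    and "r > 0"
  obtains y z where "y \<in> J - {t}" "z \<in> J - {t}" "dist y t < r" "dist z t < r" "f y \<noteq> f z"
proof (rule ccontr)
  note witness = that
  assume "\<not> thesis"
  then have const: "f y = f z" if "y \<in> J - {t}" "z \<in> J - {t}" "dist y t < r" "dist z t < r" for y z
    using that witness by blast
  obtain k where k: "\<And>y. y \<in> J - {t} \<Longrightarrow> dist y t < r \<Longrightarrow> f y = k"
    using const by metis
  have "(f \<longlongrightarrow> f t) (at t within J)"
    using has_vector_derivative_continuous[OF f(1)] by (simp add: continuous_within)
  moreover have "eventually (\<lambda>y. f y = k) (at t within J)"
    unfolding eventually_at using k \<open>r > 0\<close> by (intro exI[of _ r]) auto
  then have "(f \<longlongrightarrow> k) (at t within J)"
    by (rule tendsto_eventually)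
  ultimately have "f t = k"
    using tendsto_unique[OF proper_interval_islimpt[OF J]] by blast
  then have "((\<lambda>_. k) has_vector_derivative v) (at t within J)"
    using k by (intro has_vector_derivative_transform_within[OF f(1) \<open>r > 0\<close> J(2)]) (metis Diff_iff singletonD)
  then have "v = 0"
    by (rule vector_derivative_unique_within[OF proper_interval_islimpt[OF J] _ has_vector_derivative_const])
  then show False
    using f(2) by simp
qed

theorem lemma2p2:
  fixes X :: "'m topology" and A :: "'m chart set" and g h :: "'m tensor2"
    and W :: "'m curve set" and \<beta> :: "'m curve"
  assumes "lorentzian_4manifold X A g"
    and "orientable X A"
    and "pointon_worldlines X A W"
    and "\<beta> \<in> W"
    and "\<And>p. p \<in> topspace X \<Longrightarrow> symmetric_bilinear_on (tangent_space A p) (h p)"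
    and "\<And>p w1 w2 u. \<lbrakk>p \<in> topspace X; w1 \<in> exp_domain X A g p; w2 \<in> exp_domain X A g p;
           identified X W (exp_map X A g p w1) (exp_map X A g p w2);
           exp_map X A g p w1 \<noteq> exp_map X A g p w2; u \<in> tangent_space A p\<rbrakk>
         \<Longrightarrow> h p w1 u = h p w2 u"
  shows "\<forall>J. geodesic_segment X A g \<beta> J \<longrightarrow>
    (\<forall>t\<in>J. \<forall>u\<in>tangent_space A (snd \<beta> t).
       h (snd \<beta> t) (velocity A (fst \<beta>) (snd \<beta>) t) u = 0)"
proof (intro allI impI ballI)
  fix J t u
  assume seg: "geodesic_segment X A g \<beta> J" and t: "t \<in> J" and u: "u \<in> tangent_space A (snd \<beta> t)"
  define \<gamma> where "\<gamma> = snd \<beta>"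
  define v where "v = velocity A J \<gamma> t"
  have M: "smooth_4manifold X A"
    using assms(1) unfolding lorentzian_4manifold_def by blast
  have geo: "is_geodesic X A g J \<gamma>" and J: "J \<subseteq> fst \<beta>"
    using seg unfolding geodesic_segment_def \<gamma>_def by blast+
  note sm = is_geodesicD(1)[OF geo]
  have "is_worldline X A \<beta>"
    using assms(3,4) unfolding pointon_worldlines_def by blast
  then have "smooth_curve X A (fst \<beta>) \<gamma>"
    unfolding is_worldline_def \<gamma>_def by blast
  \<comment> \<open>From here on the velocity within the segment stands in for the one within the
    whole worldline.\<close>
  then have v_eq: "velocity A (fst \<beta>) \<gamma> t = v"
    unfolding v_def by (rule velocity_subset[OF _ smooth_curveD(1)[OF sm] J t, symmetric])
  have p: "\<gamma> t \<in> topspace X"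
    using continuous_map_image_subset_topspace[OF smooth_curveD(2)[OF sm]] t by auto
  have u': "u \<in> tangent_space A (\<gamma> t)"
    using u by (simp add: \<gamma>_def)
  have vT: "v \<in> tangent_space A (\<gamma> t)"
    unfolding v_def by (rule velocity_in_tangent_space[OF M sm t])
  have scale: "h (\<gamma> t) (tscale r v) u = r * h (\<gamma> t) v u" for r
    by (rule symmetric_bilinear_on_tscale[OF assms(5)[OF p] vT u'])
  have "h (\<gamma> t) v u = 0"
  proof (cases "\<forall>c. v c = 0")
    case True
    then have "tscale 0 v = v"
      by (simp add: tscale_def fun_eq_iff)
    then show ?thesis
      using scale[of 0] by simp
  next
    case False
    then obtain c where vc: "v c \<noteq> 0" by blast
    \<comment> \<open>Components outside the charts around the point are 0 by default, so a nonzero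
      component singles out a usable chart.\<close>
    then have c: "c \<in> A" "\<gamma> t \<in> fst c"
      unfolding v_def velocity_def by presburger+
    obtain r where r: "r > 0" "\<And>s. s \<in> J \<Longrightarrow> dist s t < r \<Longrightarrow> \<gamma> s \<in> fst c"
      using continuous_map_real_nbhd[OF smooth_curveD(2)[OF sm]
          is_chartD(1)[OF smooth_4manifoldD(2)[OF M c(1)]] t c(2)] by blast
    have "(snd c \<circ> \<gamma> has_vector_derivative v c) (at t within J)"
      using smooth_curveD(3)[OF sm c(1) t c(2), of 0] c by (simp add: v_def velocity_def)
    then obtain y z where yz: "y \<in> J - {t}" "z \<in> J - {t}" "dist y t < r" "dist z t < r"
        "(snd c \<circ> \<gamma>) y \<noteq> (snd c \<circ> \<gamma>) z"
      using nonconstant_near_nonzero_derivative[OF smooth_curveD(1)[OF sm] t _ vc r(1)] by blast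
    have exp: "tscale (s - t) v \<in> exp_domain X A g (\<gamma> t)"
      "exp_map X A g (\<gamma> t) (tscale (s - t) v) = \<gamma> s" if s: "s \<in> J - {t}" "dist s t < r" for s
    proof -
      \<comment> \<open>The whole path from t to s must lie in the chart, not just its end;
        intersecting with a ball keeps the segment within the radius r.\<close>
      have "convex (J \<inter> ball t r)"
        using smooth_curveD(1)[OF sm] by (intro convex_Int) (simp_all add: proper_interval_def is_interval_convex_1)
      then have "closed_segment t s \<subseteq> J \<inter> ball t r"
        using s t r(1) by (intro closed_segment_subset) (auto simp: dist_commute)
      then have "\<gamma> ` closed_segment t s \<subseteq> fst c"
        using r(2) by (force simp: dist_commute)
      then show "tscale (s - t) v \<in> exp_domain X A g (\<gamma> t)"
        "exp_map X A g (\<gamma> t) (tscale (s - t) v) = \<gamma> s"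
        using exp_map_scaled_velocity[OF assms(1) c(1) geo t, of "s - t"] s unfolding v_def by simp_all
    qed
    have "\<gamma> y \<noteq> \<gamma> z"
      using yz(5) by auto
    \<comment> \<open>Both points lie on the trace of \<beta>, which is a single element of the
      internal spacetime.\<close>
    moreover have "identified X W (\<gamma> y) (\<gamma> z)"
      using yz(1,2) J assms(4) unfolding identified_def internal_spacetime_def trace_of_def \<gamma>_def by blast
    ultimately have "h (\<gamma> t) (tscale (y - t) v) u = h (\<gamma> t) (tscale (z - t) v) u"
      using yz exp p u' by (intro assms(6)) simp_all
    \<comment> \<open>The base parameter t cancels in the difference of the scale factors y - t and
      z - t.\<close>
    then have "(y - z) * h (\<gamma> t) v u = 0"
      by (simp add: scale algebra_simps)
    moreover have "y \<noteq> z"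
      using yz(5) by blast
    ultimately show ?thesis by simp
  qed
  then show "h (snd \<beta> t) (velocity A (fst \<beta>) (snd \<beta>) t) u = 0"
    using v_eq by (simp add: \<gamma>_def)
qed

end
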